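(* Let $k$ be a perfect field of characteristic $p>0$, let $K$ be a field extension of $k$, let $m>0$ be an integer, and let $F$ be a formal group law over $k$ which is isomorphic (as a formal group law over $k$) to the additive formal group law $X+Y$ or to the multiplicative formal group law $X+Y+XY$. Then every $F[m]$-derivation on $K$ can be integrated to an $F$-derivation on $K$; that is, for every $F[m]$-derivation $\partial=(\partial_n)_{n<p^m}$ on $K$ there is an $F$-derivation $D=(D_n)_{n\in\mathbb{N}}$ on $K$ such that $D_n=\partial_n$ for all $n<p^m$.
   Context: Formal group laws. A formal group law over $k$ is a power series $F\in k[[X,Y]]$ with $F(X,0)=X=F(0,X)$ and $F(F(X,Y),Z)=F(X,F(Y,Z))$. A homomorphism $\alpha:F\to F'$ of formal group laws over $k$ is a power series $\alpha\in t\,k[[t]]$ with $\alpha(F(X,Y))=F'(\alpha(X),\alpha(Y))$; an isomorphism is a homomorphism having an inverse homomorphism with respect to composition of power series. HS-derivations. Let $R$ be a $k$-algebra. An HS-derivation on $R$ over $k$ is a sequence $\partial=(\partial_n:R\to R)_{n\in\mathbb{N}}$ of additive maps with $\partial_0=\mathrm{id}$, $\partial_n(xy)=\sum_{i+j=n}\partial_i(x)\partial_j(y)$ for all $n$ and all $x,y\in R$, and $\partial_n(c)=0$ for all $n>0$, $c\in k$. An $F$-derivation on $R$ is an HS-derivation $\partial$ on $R$ over $k$ which is $F$-iterative, i.e. for all $r\in R$, in $R[[X,Y]]$, $$\sum_{i,j\ge 0}\partial_i(\partial_j(r))X^iY^j=\sum_{n\ge 0}\partial_n(r)F(X,Y)^n.$$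 Truncated version. Let $k[v,w]$ denote $k[X,Y]/(X^{p^m},Y^{p^m})$ (with $v,w$ the classes of $X,Y$), and similarly $R[v,w]$. $F[m]:=F(v,w)\in k[v,w]$ is the truncation of $F$. An $m$-truncated HS-derivation on $R$ over $k$ is a sequence $\partial=(\partial_n:R\to R)_{n<p^m}$ of additive maps with $\partial_0=\mathrm{id}$, $\partial_n(xy)=\sum_{i+j=n}\partial_i(x)\partial_j(y)$ for $n<p^m$, and $\partial_n(c)=0$ for $0<n<p^m$, $c\in k$. An $F[m]$-derivation on $R$ is an $m$-truncated HS-derivation over $k$ such that for all $r\in R$, in $R[v,w]$, $$\sum_{i,j<p^m}\partial_i(\partial_j(r))v^iw^j=\sum_{n<p^m}\partial_n(r)\,F(v,w)^n.$$ *)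

theory Defs
  imports "HOL-Computational_Algebra.Computational_Algebra"
begin

section \<open>Power series in two and three variables\<close>

text \<open>
  \<open>k[[X,Y]]\<close> is \<open>k[[X]][[Y]]\<close>, i.e. the type \<open>'a fps fps\<close>, and \<open>k[[X,Y,Z]]\<close> is
  \<open>k[[X]][[Y]][[Z]]\<close>: the \<^emph>\<open>last\<close> variable is the outermost one, so the coefficient of
  \<open>X^i Y^j\<close> in \<open>F\<close> is \<open>F $ j $ i\<close>.
\<close>

abbreviation X2 :: "'a::comm_ring_1 fps fps" where "X2 \<equiv> fps_const fps_X"
abbreviation Y2 :: "'a::comm_ring_1 fps fps" where "Y2 \<equiv> fps_X"

abbreviation X3 :: "'a::comm_ring_1 fps fps fps" where "X3 \<equiv> fps_const (fps_const fps_X)"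
abbreviation Y3 :: "'a::comm_ring_1 fps fps fps" where "Y3 \<equiv> fps_const fps_X"
abbreviation Z3 :: "'a::comm_ring_1 fps fps fps" where "Z3 \<equiv> fps_X"

text \<open>
  Substitution, meant only for series \<open>A\<close>, \<open>B\<close> without constant term: then \<open>A^a B^b\<close> has order at
  least \<open>a + b\<close>, and every term that the bounds below leave out of a given coefficient is zero
  (compare the library's \<^const>\<open>fps_compose\<close>). The suffix \<open>mn\<close> says that a series in \<open>m\<close>
  variables is evaluated at series in \<open>n\<close> variables.
\<close>

definition subst12 :: "'a::comm_ring_1 fps \<Rightarrow> 'a fps fps \<Rightarrow> 'a fps fps" where
  "subst12 f A = Abs_fps (\<lambda>j. Abs_fps (\<lambda>i. \<Sum>n\<le>i+j. f $ n * (A ^ n) $ j $ i))"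

definition subst22 :: "'a::comm_ring_1 fps fps \<Rightarrow> 'a fps fps \<Rightarrow> 'a fps fps \<Rightarrow> 'a fps fps" where
  "subst22 F A B = Abs_fps (\<lambda>j. Abs_fps (\<lambda>i.
     \<Sum>a\<le>i+j. \<Sum>b\<le>i+j. F $ b $ a * (A ^ a * B ^ b) $ j $ i))"

definition subst23 ::
  "'a::comm_ring_1 fps fps \<Rightarrow> 'a fps fps fps \<Rightarrow> 'a fps fps fps \<Rightarrow> 'a fps fps fps" where
  "subst23 F A B = Abs_fps (\<lambda>l. Abs_fps (\<lambda>j. Abs_fps (\<lambda>i.
     \<Sum>a\<le>i+j+l. \<Sum>b\<le>i+j+l. F $ b $ a * (A ^ a * B ^ b) $ l $ j $ i)))"


section \<open>Formal group laws\<close>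

definition formal_group_law :: "'a::comm_ring_1 fps fps \<Rightarrow> bool" where
  "formal_group_law F \<longleftrightarrow>
     subst22 F X2 0 = X2 \<and> subst22 F 0 X2 = X2 \<and>
     subst23 F (subst23 F X3 Y3) Z3 = subst23 F X3 (subst23 F Y3 Z3)"

definition fgl_hom :: "'a::comm_ring_1 fps fps \<Rightarrow> 'a fps fps \<Rightarrow> 'a fps \<Rightarrow> bool" where
  "fgl_hom F F' \<alpha> \<longleftrightarrow>
     \<alpha> $ 0 = 0 \<and> subst12 \<alpha> F = subst22 F' (subst12 \<alpha> X2) (subst12 \<alpha> Y2)"

definition fgl_isomorphic :: "'a::comm_ring_1 fps fps \<Rightarrow> 'a fps fps \<Rightarrow> bool" where
  "fgl_isomorphic F F' \<longleftrightarrow>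
     (\<exists>\<alpha> \<beta>. fgl_hom F F' \<alpha> \<and> fgl_hom F' F \<beta> \<and> \<alpha> oo \<beta> = fps_X \<and> \<beta> oo \<alpha> = fps_X)"

definition additive_fgl :: "'a::comm_ring_1 fps fps" where
  "additive_fgl = X2 + Y2"

definition multiplicative_fgl :: "'a::comm_ring_1 fps fps" where
  "multiplicative_fgl = X2 + Y2 + X2 * Y2"


section \<open>Perfect fields and algebras\<close>

definition perfect_field :: "'a::field itself \<Rightarrow> bool" where
  "perfect_field _ \<longleftrightarrow> CHAR('a) = 0 \<or> surj (\<lambda>x::'a. x ^ CHAR('a))"

text \<open>
  A \<open>k\<close>-algebra structure on a commutative ring \<open>R\<close> is a unital ring homomorphism \<open>k \<rightarrow> R\<close>. If \<open>k\<close>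
  and \<open>R\<close> are fields it is automatically injective, so it is the same as a field extension \<open>R/k\<close>.
\<close>

definition algebra_map :: "('k::comm_ring_1 \<Rightarrow> 'r::comm_ring_1) \<Rightarrow> bool" where
  "algebra_map \<phi> \<longleftrightarrow>
     \<phi> 1 = 1 \<and> (\<forall>a b. \<phi> (a + b) = \<phi> a + \<phi> b) \<and> (\<forall>a b. \<phi> (a * b) = \<phi> a * \<phi> b)"


section \<open>HS-derivations and iterativity\<close>

definition HS_derivation ::
  "('k::comm_ring_1 \<Rightarrow> 'r::comm_ring_1) \<Rightarrow> (nat \<Rightarrow> 'r \<Rightarrow> 'r) \<Rightarrow> bool" where
  "HS_derivation \<phi> D \<longleftrightarrow>
     (\<forall>n x y. D n (x + y) = D n x + D n y) \<and>
     D 0 = id \<and>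
     (\<forall>n x y. D n (x * y) = (\<Sum>i\<le>n. D i x * D (n - i) y)) \<and>
     (\<forall>n>0. \<forall>c. D n (\<phi> c) = 0)"

definition map_coeffs2 :: "('k \<Rightarrow> 'r) \<Rightarrow> 'k fps fps \<Rightarrow> 'r fps fps" where
  "map_coeffs2 \<phi> F = Abs_fps (\<lambda>j. Abs_fps (\<lambda>i. \<phi> (F $ j $ i)))"

text \<open>
  The right-hand side \<open>\<Sum>n. D n r * F(X,Y)^n\<close> of the iterativity condition is the power series
  \<open>\<Sum>n. D n r * T^n\<close> evaluated at \<open>T = F(X,Y)\<close>.
\<close>

definition F_derivation ::
  "('k::comm_ring_1 \<Rightarrow> 'r::comm_ring_1) \<Rightarrow> 'k fps fps \<Rightarrow> (nat \<Rightarrow> 'r \<Rightarrow> 'r) \<Rightarrow> bool" where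
  "F_derivation \<phi> F D \<longleftrightarrow>
     HS_derivation \<phi> D \<and>
     (\<forall>r. Abs_fps (\<lambda>j. Abs_fps (\<lambda>i. D i (D j r))) =
          subst12 (Abs_fps (\<lambda>n. D n r)) (map_coeffs2 \<phi> F))"


section \<open>The truncated version\<close>

text \<open>
  A truncated sequence \<open>(\<partial>\<^sub>n)\<close>, \<open>n < q\<close>, is the restriction of a function on all of \<^typ>\<open>nat\<close>; its
  values at \<open>n \<ge> q\<close> are irrelevant.
\<close>

definition truncated_HS_derivation ::
  "nat \<Rightarrow> ('k::comm_ring_1 \<Rightarrow> 'r::comm_ring_1) \<Rightarrow> (nat \<Rightarrow> 'r \<Rightarrow> 'r) \<Rightarrow> bool" where
  "truncated_HS_derivation q \<phi> D \<longleftrightarrow>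
     (\<forall>n<q. \<forall>x y. D n (x + y) = D n x + D n y) \<and>
     D 0 = id \<and>
     (\<forall>n<q. \<forall>x y. D n (x * y) = (\<Sum>i\<le>n. D i x * D (n - i) y)) \<and>
     (\<forall>n. 0 < n \<and> n < q \<longrightarrow> (\<forall>c. D n (\<phi> c) = 0))"

text \<open>
  \<open>R[X,Y] = R[X][Y]\<close> is the type \<open>'r poly poly\<close>, with \<open>Y\<close> the outer variable as above. Elements of
  \<open>R[v,w] = R[X,Y]/(X^q,Y^q)\<close> are represented by polynomials, and equality in \<open>R[v,w]\<close> is congruence
  modulo the ideal \<open>(X^q,Y^q)\<close>.
\<close>

definition trunc_cong :: "nat \<Rightarrow> 'r::comm_ring_1 poly poly \<Rightarrow> 'r poly poly \<Rightarrow> bool" where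
  "trunc_cong q A B \<longleftrightarrow>
     (\<exists>U V. A - B = [:monom 1 q:] * U + monom 1 q * V)"

text \<open>
  The representative of \<open>F(v,w)\<close> with all exponents of \<open>X\<close> and of \<open>Y\<close> less than \<open>q\<close>.
\<close>

definition trunc2 :: "nat \<Rightarrow> 'a::comm_ring_1 fps fps \<Rightarrow> 'a poly poly" where
  "trunc2 q F = map_poly (truncate_fps q) (truncate_fps q F)"

text \<open>With \<open>q = p^m\<close> this is the notion of an \<open>F[m]\<close>-derivation.\<close>

definition truncated_F_derivation ::
  "nat \<Rightarrow> ('k::comm_ring_1 \<Rightarrow> 'r::comm_ring_1) \<Rightarrow> 'k fps fps \<Rightarrow> (nat \<Rightarrow> 'r \<Rightarrow> 'r) \<Rightarrow> bool" where
  "truncated_F_derivation q \<phi> F D \<longleftrightarrow>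
     truncated_HS_derivation q \<phi> D \<and>
     (\<forall>r. trunc_cong q
            (\<Sum>i<q. \<Sum>j<q. monom (monom (D i (D j r)) i) j)
            (\<Sum>n<q. [:[:D n r:]:] * map_poly (map_poly \<phi>) (trunc2 q F) ^ n))"

end

theory Submission
  imports Defs
begin

text \<open>
  An isomorphism \<open>F \<cong> G\<close> turns \<open>F\<close>-derivations into \<open>G\<close>-derivations, so \<open>F\<close> may be taken to be
  \<open>X + Y + e X Y\<close> with \<open>e \<in> {0, 1}\<close>. If \<open>\<delta>\<^sub>1 = 0\<close>, only the components with index divisible by \<open>p\<close>
  survive and reindexing lowers \<open>m\<close>. Otherwise \<open>\<delta>\<^sub>q\<^sub>-\<^sub>1 \<noteq> 0\<close> for \<open>q = p^m\<close>, and from it one gets a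
  coordinate \<open>x\<close> with \<open>\<delta>(x) = x + g X\<close>, where \<open>g = 1\<close> (\<open>e = 0\<close>) or \<open>g = x\<close> (\<open>e = 1\<close>), such that
  \<open>K = C(x)\<close> for the field \<open>C\<close> of constants. By Zorn's lemma there are subfields
  \<open>C = M\<^sub>0 \<supseteq> M\<^sub>1 \<supseteq> \<dots>\<close> containing \<open>k = k^p\<close> such that \<open>x\<close> has degree \<open>p^(m+n)\<close> over \<open>M\<^sub>n\<close>, is purely
  inseparable over it and generates \<open>K\<close>. The substitution \<open>h(x) \<mapsto> h(x + g X)\<close> for \<open>h \<in> M\<^sub>n[T]\<close> is well
  defined modulo \<open>X^(p^(m+n))\<close>, and these maps fit together to the required derivation.
\<close>

section \<open>Purely inseparable extensions\<close>

text \<open>Over C itself the substitution is determined only modulo X^q: the minimal polynomial of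
  x over C is (T - x)^q, and T - x goes to g X. Components of higher index need smaller coefficient
  fields, over which x has larger degree. Nothing is assumed about the degree of K over K^p, so
  these fields come from maximality: M_(n+1) is maximal among the subrings of M_n that contain M_n^p
  and miss x^(p^(m+n)). No single M_n determines all of D, so each component is read off at its own
  level.

  Perfectness of k keeps k inside every M_n, so that the positive components of D vanish on k. From
  e = 0 or e = 1 one has e^p = e, hence F(X,Y)^p = F(X^p,Y^p), which is why reindexing by p respects
  iterativity.

  The component \<delta>_(q-1) plays the part of a trace: g \<delta>_(q-1) takes constant values,
  and the coefficient of X^(q-1) in (\<delta>(x) - x)^(q-1) \<delta>(y) expresses every y through
  such values and powers of x. This yields K = C(x).\<close>

definition is_subring :: "'a::comm_ring_1 set \<Rightarrow> bool" where
  "is_subring M \<longleftrightarrow>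
     0 \<in> M \<and> 1 \<in> M \<and> (\<forall>a\<in>M. - a \<in> M) \<and> (\<forall>a\<in>M. \<forall>b\<in>M. a + b \<in> M \<and> a * b \<in> M)"

definition polys_over :: "'a::comm_ring_1 set \<Rightarrow> 'a poly set" where
  "polys_over M = {h. \<forall>i. coeff h i \<in> M}"

definition adjoin :: "'a::comm_ring_1 set \<Rightarrow> 'a \<Rightarrow> 'a set" where
  "adjoin M x = {poly h x |h. h \<in> polys_over M}"

section \<open>Closure properties of subrings and of adjunction\<close>

lemma subring_diff: "is_subring M \<Longrightarrow> a \<in> M \<Longrightarrow> b \<in> M \<Longrightarrow> a - b \<in> M"
  by (metis is_subring_def diff_conv_add_uminus)

lemma subring_power: "is_subring M \<Longrightarrow> a \<in> M \<Longrightarrow> a ^ n \<in> M"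
  by (induction n) (auto simp: is_subring_def)

lemma subring_of_nat: "is_subring M \<Longrightarrow> of_nat n \<in> M"
  by (induction n) (auto simp: is_subring_def)

lemma subring_sum: "is_subring M \<Longrightarrow> (\<And>i. i \<in> A \<Longrightarrow> f i \<in> M) \<Longrightarrow> sum f A \<in> M"
  by (induction A rule: infinite_finite_induct) (auto simp: is_subring_def)

lemma polys_over_monom: "is_subring M \<Longrightarrow> c \<in> M \<Longrightarrow> monom c n \<in> polys_over M"
  by (auto simp: polys_over_def is_subring_def)

lemma polys_over_const: "is_subring M \<Longrightarrow> c \<in> M \<Longrightarrow> [:c:] \<in> polys_over M"
  using polys_over_monom[of M c 0] by (simp add: monom_0)

lemma is_subring_polys_over: "is_subring M \<Longrightarrow> is_subring (polys_over M)"
  unfolding is_subring_def[of "polys_over M"]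
proof (intro conjI ballI)
  assume M: "is_subring M"
  show "0 \<in> polys_over M" "1 \<in> polys_over M"
    using M by (auto simp: polys_over_def is_subring_def coeff_1)
  show "- a \<in> polys_over M" if "a \<in> polys_over M" for a
    using that M by (auto simp: polys_over_def is_subring_def)
  show "a + b \<in> polys_over M" if "a \<in> polys_over M" "b \<in> polys_over M" for a b
    using that M by (auto simp: polys_over_def is_subring_def)
  show "a * b \<in> polys_over M" if "a \<in> polys_over M" "b \<in> polys_over M" for a b
    unfolding polys_over_def mem_Collect_eq coeff_mult
    by (intro allI subring_sum[OF M]) (use that M in \<open>auto simp: polys_over_def is_subring_def\<close>)
qed

lemma is_subring_adjoin: "is_subring M \<Longrightarrow> is_subring (adjoin M x)"
  unfolding is_subring_def[of "adjoin M x"]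
proof (intro conjI ballI)
  assume "is_subring M"
  then have P: "is_subring (polys_over M)" by (rule is_subring_polys_over)
  let ?A = "adjoin M x"
  have I: "poly h x \<in> ?A" if "h \<in> polys_over M" for h using that by (auto simp: adjoin_def)
  show "0 \<in> ?A" "1 \<in> ?A"
    using P I[of 0] I[of 1] by (auto simp: is_subring_def)
  show "- a \<in> ?A" if a: "a \<in> ?A" for a
  proof -
    obtain f where "f \<in> polys_over M" "a = poly f x" using a by (auto simp: adjoin_def)
    then show ?thesis using I[of "- f"] P by (simp add: is_subring_def)
  qed
  show "a + b \<in> ?A" "a * b \<in> ?A" if ab: "a \<in> ?A" "b \<in> ?A" for a b
  proof -
    obtain f g where "f \<in> polys_over M" "a = poly f x" "g \<in> polys_over M" "b = poly g x"
      using ab by (auto simp: adjoin_def)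
    then show "a + b \<in> ?A" "a * b \<in> ?A"
      using I[of "f + g"] I[of "f * g"] P by (simp_all add: is_subring_def)
  qed
qed

lemma adjoin_base: "is_subring M \<Longrightarrow> a \<in> M \<Longrightarrow> a \<in> adjoin M x"
  unfolding adjoin_def using polys_over_const[of M a] by force

lemma adjoin_gen: "is_subring M \<Longrightarrow> x \<in> adjoin M x"
  unfolding adjoin_def using polys_over_monom[of M 1 1] 
  by (force simp: is_subring_def poly_monom)

lemma poly_in_subring:
  assumes "is_subring M" "h \<in> polys_over M" "x \<in> M"
  shows "poly h x \<in> M"
proof -
  have "coeff h i * x ^ i \<in> M" for i
    using assms subring_power[OF assms(1,3), of i] by (auto simp: polys_over_def is_subring_def)
  then show ?thesis unfolding poly_altdef by (intro subring_sum[OF assms(1)])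
qed

lemma polys_over_mono: "M \<subseteq> M' \<Longrightarrow> polys_over M \<subseteq> polys_over M'"
  by (auto simp: polys_over_def)

lemma adjoin_least: "is_subring M' \<Longrightarrow> M \<subseteq> M' \<Longrightarrow> x \<in> M' \<Longrightarrow> adjoin M x \<subseteq> M'"
  unfolding adjoin_def by (blast intro: poly_in_subring[of M'] polys_over_mono[THEN subsetD])

section \<open>Minimal polynomials of purely inseparable elements\<close>

lemma power_linear_prime_char:
  fixes x :: "'a::field"
  assumes "prime CHAR('a)" "q = CHAR('a) ^ N"
  shows "[:- x, 1:] ^ q = monom 1 q - [:x ^ q:]"
proof -
  have "(monom 1 1 - [:x:]) ^ q + [:x:] ^ q = ((monom 1 1 - [:x:]) + [:x:]) ^ q"
    by (rule freshmans_dream'[symmetric]) (use assms in auto)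
  then have "(monom 1 1 - [:x:]) ^ q = monom 1 q - [:x ^ q:]"
    by (simp add: monom_power poly_const_pow eq_diff_eq)
  moreover have "monom 1 1 - [:x:] = [:- x, 1:]"
    by (simp add: monom_Suc monom_0)
  ultimately show ?thesis by simp
qed

text \<open>T - x is prime, so when it does not divide s it divides the cofactor of s, and one
  linear factor can be cancelled on both sides.\<close>

lemma dvd_linear_power_const:
  fixes s :: "'a::field poly"
  assumes "s dvd [:- x, 1:] ^ n" "poly s x \<noteq> 0"
  shows "\<exists>c. s = [:c:]"
  using assms(1)
proof (induction n)
  case 0
  then have "is_unit s" by simp
  then show ?case unfolding is_unit_poly_iff by blast
next
  case (Suc n)
  then obtain r where r: "[:- x, 1:] ^ Suc n = s * r" by (elim dvdE)
  have "poly s x * poly r x = poly ([:- x, 1:] ^ Suc n) x" unfolding r by simp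
  also have "\<dots> = 0" by (simp add: poly_power)
  finally have "poly s x * poly r x = 0" .
  then have "[:- x, 1:] dvd r" using assms(2) by (simp add: poly_eq_0_iff_dvd)
  then obtain r' where "r = [:- x, 1:] * r'" by (elim dvdE)
  with r have "[:- x, 1:] * [:- x, 1:] ^ n = [:- x, 1:] * (s * r')" by (simp only: power_Suc mult_ac)
  then have "[:- x, 1:] ^ n = s * r'" by (metis mult_cancel_left pCons_eq_0_iff one_neq_zero)
  then show ?case using Suc.IH by auto
qed

lemma coeff_binomial_power:
  fixes z :: "'a::comm_ring_1"
  assumes "P > 0" "u > 0"
  shows "coeff ((monom 1 P - [:z:]) ^ u) (P * (u - 1)) = - of_nat u * z"
proof -
  have "monom 1 P - [:z:] = monom 1 P + [:- z:]" by simp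
  then have "(monom 1 P - [:z:]) ^ u = (\<Sum>k\<le>u. of_nat (u choose k) * monom 1 P ^ k * [:- z:] ^ (u - k))"
    by (simp only: binomial_ring)
  also have "\<dots> = (\<Sum>k\<le>u. monom (of_nat (u choose k) * (- z) ^ (u - k)) (P * k))"
    by (intro sum.cong refl)
       (simp add: monom_power poly_const_pow of_nat_poly smult_monom mult.commute)
  finally have "coeff ((monom 1 P - [:z:]) ^ u) (P * (u - 1)) =
      (\<Sum>k\<le>u. if k = u - 1 then of_nat (u choose k) * (- z) ^ (u - k) else 0)"
    using assms by (auto simp: coeff_sum intro!: sum.cong)
  also have "\<dots> = - of_nat u * z"
    using assms binomial_symmetric[of 1 u] by (simp add: sum.delta)
  finally show ?thesis .
qed

text \<open>The minimal polynomial of \<open>x\<close> over \<open>M\<close> divides \<open>T^(p^(N+1)) - x^(p^(N+1)) = (T - x)^(p^(N+1))\<close>,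
  so it is \<open>(T - x)^d\<close>. If \<open>d = p^e u\<close> with \<open>p\<close> not dividing \<open>u\<close>, its coefficient of
  \<open>T^(d - p^e)\<close> is \<open>- u x^(p^e)\<close>.\<close>

lemma root_over_subfield_dvd:
  fixes x :: "'a::field"
  assumes p: "prime p" "p = CHAR('a)"
    and M: "is_subring M" "\<And>a. a \<in> M \<Longrightarrow> inverse a \<in> M"
    and xM: "x ^ (p ^ Suc N) \<in> M" "x ^ (p ^ N) \<notin> M"
    and h: "h \<in> polys_over M" "poly h x = 0"
  shows "[:- x, 1:] ^ (p ^ Suc N) dvd h"
proof -
  define Q where "Q = p ^ Suc N"
  define I where "I = {h \<in> polys_over M. poly h x = 0}"
  note PM = is_subring_polys_over[OF M(1)]
  have Q: "[:- x, 1:] ^ Q = monom 1 Q - [:x ^ Q:]"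
    unfolding Q_def using p by (intro power_linear_prime_char[where N = "Suc N"]) auto
  have Q0: "Q > 0" using p prime_gt_0_nat by (simp add: Q_def)
  have QI: "[:- x, 1:] ^ Q \<in> I"
    unfolding I_def
  proof (intro CollectI conjI)
    show "[:- x, 1:] ^ Q \<in> polys_over M"
      unfolding Q using M(1) xM(1) by (intro subring_diff[OF PM] polys_over_monom polys_over_const)
        (auto simp: Q_def is_subring_def)
    show "poly ([:- x, 1:] ^ Q) x = 0" using Q0 by (simp add: poly_power)
  qed
  have "\<exists>g. g \<in> I \<and> g \<noteq> 0" using QI by (intro exI[of _ "[:- x, 1:] ^ Q"]) auto
  then obtain g where g: "g \<in> I" "g \<noteq> 0"
    and gmin: "\<And>f. f \<in> I \<Longrightarrow> f \<noteq> 0 \<Longrightarrow> degree g \<le> degree f"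
    using ex_has_least_nat[of "\<lambda>g. g \<in> I \<and> g \<noteq> 0" _ degree] by metis
  define h0 where "h0 = [:inverse (lead_coeff g):] * g"
  have h0I: "h0 \<in> I"
  proof -
    have "[:inverse (lead_coeff g):] \<in> polys_over M"
      using g M by (intro polys_over_const) (auto simp: I_def polys_over_def)
    then have "h0 \<in> polys_over M" unfolding h0_def using g PM by (auto simp: is_subring_def I_def)
    moreover have "poly h0 x = 0" using g by (simp add: h0_def I_def)
    ultimately show ?thesis by (simp add: I_def)
  qed
  have h0lc: "lead_coeff h0 = 1" and h0deg: "degree h0 = degree g"
    using g by (simp_all add: h0_def)
  \<comment> \<open>Division with remainder, one leading term at a time: \<open>h0\<close> is monic
    with coefficients in \<open>M\<close>, so each difference stays in \<open>I\<close>, and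
    minimality of the degree makes the process end at 0.\<close>
  have dvd: "h0 dvd f" if "f \<in> I" for f
    using that
  proof (induction "degree f" arbitrary: f rule: less_induct)
    case less
    show ?case
    proof (cases "f = 0")
      case False
      then have deg: "degree h0 \<le> degree f" using gmin less.prems h0deg by simp
      define t where "t = monom (lead_coeff f) (degree f - degree h0)"
      define f' where "f' = f - t * h0"
      have "t \<in> polys_over M"
        unfolding t_def using less.prems by (intro polys_over_monom M) (auto simp: I_def polys_over_def)
      then have f'I: "f' \<in> I"
        using less.prems h0I PM unfolding I_def f'_def
        by (auto intro!: subring_diff[OF PM] simp: is_subring_def)
      show ?thesis
      proof (cases "f' = 0")
        case True
        then show ?thesis by (simp add: f'_def)
      next
        case nz: False
        have tdeg: "degree (t * h0) \<le> degree f"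
          using degree_mult_le[of t h0] degree_monom_le[of "lead_coeff f" "degree f - degree h0"] deg
          unfolding t_def by linarith
        have "coeff (t * h0) (degree f) = lead_coeff f"
          using deg h0lc by (simp add: t_def coeff_monom_mult)
        then have "coeff f' (degree f) = 0" by (simp add: f'_def)
        moreover have "degree f' \<le> degree f"
          unfolding f'_def using tdeg by (intro degree_diff_le) auto
        ultimately have "degree f' < degree f"
          using nz by (metis le_neq_implies_less leading_coeff_0_iff)
        then have "h0 dvd f'" using less.hyps f'I by blast
        then show ?thesis using dvd_add[of h0 f' "t * h0"] by (simp add: f'_def)
      qed
    qed simp
  qed
  have h0nz: "h0 \<noteq> 0" using h0lc by auto
  define d where "d = order x h0"
  obtain s where s: "h0 = [:- x, 1:] ^ d * s" "\<not> [:- x, 1:] dvd s"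
    using order_decomp[OF h0nz] unfolding d_def by blast
  have "s dvd [:- x, 1:] ^ Q" using dvd[OF QI] s(1) by (metis dvd_mult_right)
  then obtain c where c: "s = [:c:]" using dvd_linear_power_const s(2) poly_eq_0_iff_dvd by blast
  have h0eq: "h0 = [:- x, 1:] ^ d"
  proof -
    have "lead_coeff h0 = c" unfolding s(1) c lead_coeff_mult lead_coeff_power by simp
    then have "c = 1" using h0lc by simp
    then show ?thesis using s(1) c by simp
  qed
  have "d \<noteq> 0" using h0I h0eq by (auto simp: I_def)
  have "\<not> d < Q"
  proof
    assume dQ: "d < Q"
    obtain u where u: "d = p ^ multiplicity p d * u" "\<not> p dvd u"
      using multiplicity_decompose'[of d p] \<open>d \<noteq> 0\<close> p(1) by (metis not_prime_unit)
    define e where "e = multiplicity p d"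
    have u0: "u > 0" using u \<open>d \<noteq> 0\<close> by (cases u) auto
    have "p ^ e \<le> d" using u0 by (subst u(1)) (simp add: e_def)
    then have "p ^ e < p ^ Suc N" using dQ by (simp add: Q_def)
    then have eN: "e \<le> N" 
      using power_less_imp_less_exp[OF prime_gt_1_nat[OF p(1)], of e "Suc N"] by simp
    have "h0 = (monom 1 (p ^ e) - [:x ^ (p ^ e):]) ^ u"
    proof -
      have "h0 = ([:- x, 1:] ^ (p ^ e)) ^ u"
        unfolding h0eq using u(1) by (simp only: e_def flip: power_mult)
      moreover have "[:- x, 1:] ^ (p ^ e) = monom 1 (p ^ e) - [:x ^ (p ^ e):]"
        using p by (intro power_linear_prime_char) auto
      ultimately show ?thesis by simp
    qed
    then have "coeff h0 (p ^ e * (u - 1)) = - of_nat u * x ^ (p ^ e)"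
      using coeff_binomial_power[of "p ^ e" u] u0 p(1) prime_gt_0_nat by simp
    moreover have "coeff h0 (p ^ e * (u - 1)) \<in> M" using h0I by (simp add: I_def polys_over_def)
    ultimately have "- of_nat u * x ^ (p ^ e) \<in> M" by simp
    moreover have "inverse (- of_nat u) \<in> M"
      using M subring_of_nat[OF M(1), of u] by (intro M(2)) (simp add: is_subring_def)
    ultimately have "inverse (- of_nat u) * (- of_nat u * x ^ (p ^ e)) \<in> M"
      using M(1) unfolding is_subring_def by blast
    moreover have "(of_nat u :: 'a) \<noteq> 0" using u(2) p(2) by (simp add: of_nat_eq_0_iff_char_dvd)
    ultimately have "x ^ (p ^ e) \<in> M" by (simp flip: mult.assoc)
    \<comment> \<open>Since e <= N, a further power of this element of \<open>M\<close> is the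
      excluded element x^(p^N).\<close>
    then have "(x ^ (p ^ e)) ^ (p ^ (N - e)) \<in> M" by (rule subring_power[OF M(1)])
    then show False using eN xM(2) by (simp flip: power_mult power_add)
  qed
  then have "[:- x, 1:] ^ Q dvd h0" unfolding h0eq by (intro le_imp_power_dvd) simp
  moreover have "h0 dvd h" using h by (intro dvd) (simp add: I_def)
  ultimately show ?thesis unfolding Q_def by (rule dvd_trans)
qed

section \<open>Frobenius images, inverses and the exchange property\<close>

lemma is_subring_frobenius_image:
  fixes M :: "'a::field set"
  assumes "prime CHAR('a)" "is_subring M"
  shows "is_subring ((\<lambda>a. a ^ CHAR('a)) ` M)"
proof -
  let ?p = "CHAR('a)"
  have I: "a ^ ?p \<in> (\<lambda>a. a ^ ?p) ` M" if "a \<in> M" for a using that by blast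
  show ?thesis
    unfolding is_subring_def[of "_ ` _"]
  proof (intro conjI ballI)
    have "0 = (0::'a) ^ ?p" using assms(1) prime_gt_0_nat by simp
    then show "0 \<in> (\<lambda>a. a ^ ?p) ` M" using assms(2) by (metis I is_subring_def)
    show "1 \<in> (\<lambda>a. a ^ ?p) ` M" using I[of 1] assms(2) by (simp add: is_subring_def)
    show "- b \<in> (\<lambda>a. a ^ ?p) ` M" if b: "b \<in> (\<lambda>a. a ^ ?p) ` M" for b
    proof -
      obtain a where a: "b = a ^ ?p" "a \<in> M" using b by blast
      \<comment> \<open>Additivity of the p-th power gives (-a)^p = -(a^p) without separating p = 2
        from odd p.\<close>
      have "a ^ ?p + (- a) ^ ?p = (a + (- a)) ^ ?p" by (rule freshmans_dream[symmetric]) (use assms in auto)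
      also have "\<dots> = 0" using assms(1) prime_gt_0_nat by simp
      finally have "- b = (- a) ^ ?p" using a by (simp add: add_eq_0_iff2)
      then show ?thesis using I[of "- a"] a assms(2) by (simp add: is_subring_def)
    qed
    show "b + c \<in> (\<lambda>a. a ^ ?p) ` M" "b * c \<in> (\<lambda>a. a ^ ?p) ` M"
      if bc: "b \<in> (\<lambda>a. a ^ ?p) ` M" "c \<in> (\<lambda>a. a ^ ?p) ` M" for b c
    proof -
      obtain a a' where a: "b = a ^ ?p" "a \<in> M" "c = a' ^ ?p" "a' \<in> M" using bc by blast
      have "b + c = (a + a') ^ ?p" using freshmans_dream[of ?p a a'] assms(1) a by simp
      moreover have "b * c = (a * a') ^ ?p" using a by (simp add: power_mult_distrib)
      ultimately show "b + c \<in> (\<lambda>a. a ^ ?p) ` M" "b * c \<in> (\<lambda>a. a ^ ?p) ` M"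
        using a assms(2) by (auto simp: is_subring_def)
    qed
  qed
qed

text \<open>1/a = a^(Q-1) (1/a)^Q. A subring containing all Q-th powers of the field is thus a
  subfield, which is why closure under inverses is not part of \<open>is_subring\<close>.\<close>

lemma subring_inverse:
  fixes a :: "'a::field"
  assumes "is_subring M" "\<And>u. u ^ Q \<in> M" "Q > 0" "a \<in> M"
  shows "inverse a \<in> M"
proof (cases "a = 0")
  case False
  have "a ^ (Q - 1) * inverse a ^ Q \<in> M"
    using assms subring_power[OF assms(1,4)] by (auto simp: is_subring_def)
  also have "a ^ (Q - 1) * inverse a ^ Q = inverse a"
    using False assms(3) by (cases Q) (simp_all add: field_simps)
  finally show ?thesis .
qed (use assms in \<open>auto simp: is_subring_def\<close>)

text \<open>Exponents of y are reduced modulo p by absorbing powers of y^p into the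
  coefficients.\<close>

lemma adjoin_reduce:
  assumes "is_subring M" "y ^ p \<in> M" "p > 0" "z \<in> adjoin M y"
  obtains h where "h \<in> polys_over M" "poly h y = z" "\<And>i. i \<ge> p \<Longrightarrow> coeff h i = 0"
proof -
  note P = is_subring_polys_over[OF assms(1)]
  obtain g where g: "g \<in> polys_over M" "z = poly g y" using assms(4) by (auto simp: adjoin_def)
  define h where "h = (\<Sum>i\<le>degree g. monom (coeff g i * (y ^ p) ^ (i div p)) (i mod p))"
  have "coeff g i * (y ^ p) ^ (i div p) \<in> M" for i
    using g assms(1) subring_power[OF assms(1,2)] by (auto simp: polys_over_def is_subring_def)
  then have "h \<in> polys_over M"
    unfolding h_def using assms(1) by (intro subring_sum[OF P] polys_over_monom)
  moreover have "poly h y = z"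
    unfolding h_def g(2) poly_altdef[of g] poly_sum poly_monom
    by (intro sum.cong refl) (simp add: mult.assoc flip: power_mult power_add)
  moreover have "coeff h i = 0" if "i \<ge> p" for i
    unfolding h_def coeff_sum using that assms(3)
    by (intro sum.neutral) (auto, metis mod_less_divisor not_less)
  ultimately show ?thesis by (rule that)
qed

text \<open>If y were not in M(z), its minimal polynomial over M(z) would be (T - y)^p. But z = h(y)
  with h over M of degree below p, and h - z vanishes at y, so h would be the constant z and z would
  lie in M.\<close>

lemma adjoin_exchange:
  fixes y z :: "'a::field"
  assumes p: "prime p" "p = CHAR('a)"
    and M: "is_subring M" "\<And>u. u ^ Q \<in> M" "Q > 0"
    and y: "y ^ p \<in> M" and z: "z \<in> adjoin M y" "z \<notin> M"
  shows "y \<in> adjoin M z"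
proof (rule ccontr)
  assume yz: "y \<notin> adjoin M z"
  have p0: "p > 0" using p prime_gt_0_nat by blast
  obtain h where h: "h \<in> polys_over M" "poly h y = z" "\<And>i. i \<ge> p \<Longrightarrow> coeff h i = 0"
    using adjoin_reduce[OF M(1) y p0 z(1)] by blast
  let ?M = "adjoin M z"
  have M': "is_subring ?M" using M(1) by (rule is_subring_adjoin)
  have sub: "M \<subseteq> ?M" using adjoin_base[OF M(1)] by blast
  have hz: "h - [:z:] \<in> polys_over ?M"
    using polys_over_mono[OF sub] h(1) adjoin_gen[OF M(1)]
    by (intro subring_diff is_subring_polys_over polys_over_const M') auto
  have "[:- y, 1:] ^ (p ^ Suc 0) dvd h - [:z:]"
  proof (rule root_over_subfield_dvd[OF p M'])
    show "inverse a \<in> ?M" if "a \<in> ?M" for a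
      using M sub that by (intro subring_inverse[OF M', of Q]) auto
    show "y ^ p ^ Suc 0 \<in> ?M" "y ^ p ^ 0 \<notin> ?M" using y sub yz by auto
    show "h - [:z:] \<in> polys_over ?M" by (fact hz)
    show "poly (h - [:z:]) y = 0" using h by simp
  qed
  then have d: "[:- y, 1:] ^ p dvd h - [:z:]" by simp
  have "h - [:z:] = 0"
  proof (rule ccontr)
    assume nz: "h - [:z:] \<noteq> 0"
    then have "p \<le> degree (h - [:z:])"
      using dvd_imp_degree_le[OF d] by (simp add: degree_linear_power)
    then have "coeff (h - [:z:]) (degree (h - [:z:])) = 0"
      using h(3) p0 by (simp add: coeff_pCons split: nat.split)
    then show False using nz by (simp only: leading_coeff_0_iff)
  qed
  then have "z = coeff h 0" by (metis coeff_pCons_0 eq_iff_diff_eq_0)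
  then show False using h(1) z(2) by (auto simp: polys_over_def)
qed

text \<open>For a maximal M, every y in C outside M has z in M(y), since M(y) is strictly larger;
  the exchange property then puts y into M(z).\<close>

lemma maximal_subring_avoiding:
  fixes z :: "'a::field"
  assumes p: "prime p" "p = CHAR('a)"
    and C: "is_subring C" "\<And>u. u ^ Q \<in> C" "Q > 0"
    and z: "z \<in> C" "z \<notin> (\<lambda>a. a ^ p) ` C"
  obtains M where "is_subring M" "(\<lambda>a. a ^ p) ` C \<subseteq> M" "M \<subseteq> C" "z \<notin> M" "C \<subseteq> adjoin M z"
proof -
  let ?Cp = "(\<lambda>a. a ^ p) ` C"
  define \<A> where "\<A> = {M. is_subring M \<and> ?Cp \<subseteq> M \<and> M \<subseteq> C \<and> z \<notin> M}"
  \<comment> \<open>The Frobenius image of \<open>C\<close> misses \<open>z\<close> by hypothesis,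
    so the family is not empty.\<close>
  have "?Cp \<in> \<A>"
    using is_subring_frobenius_image[of C] p C(1) z subring_power[OF C(1)] by (auto simp: \<A>_def)
  have "\<exists>M\<in>\<A>. \<forall>X\<in>\<A>. M \<subseteq> X \<longrightarrow> X = M"
  proof (rule subset_Zorn_nonempty)
    show "\<A> \<noteq> {}" using \<open>?Cp \<in> \<A>\<close> by blast
    fix \<C> assume ne: "\<C> \<noteq> {}" and ch: "subset.chain \<A> \<C>"
    have sub: "\<C> \<subseteq> \<A>" using ch by (simp add: subset.chain_def)
    have R: "is_subring X" if "X \<in> \<C>" for X using sub that by (auto simp: \<A>_def)
    have two: "\<exists>X\<in>\<C>. a \<in> X \<and> b \<in> X" if "a \<in> \<Union>\<C>" "b \<in> \<Union>\<C>" for a b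
    proof -
      obtain X Y where XY: "X \<in> \<C>" "a \<in> X" "Y \<in> \<C>" "b \<in> Y" using \<open>a \<in> \<Union>\<C>\<close> \<open>b \<in> \<Union>\<C>\<close> by blast
      then have "X \<subseteq> Y \<or> Y \<subseteq> X" using ch by (auto simp: subset.chain_def)
      then show ?thesis using XY by blast
    qed
    have "is_subring (\<Union>\<C>)"
      unfolding is_subring_def
    proof (intro conjI ballI)
      show "0 \<in> \<Union>\<C>" "1 \<in> \<Union>\<C>" using ne R by (auto simp: is_subring_def)
      show "- a \<in> \<Union>\<C>" if "a \<in> \<Union>\<C>" for a using that R by (auto simp: is_subring_def)
      show "a + b \<in> \<Union>\<C>" "a * b \<in> \<Union>\<C>" if ab: "a \<in> \<Union>\<C>" "b \<in> \<Union>\<C>" for a b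
      proof -
        obtain X where "X \<in> \<C>" "a \<in> X" "b \<in> X" using two[OF ab] by blast
        then show "a + b \<in> \<Union>\<C>" "a * b \<in> \<Union>\<C>"
          using R[of X] unfolding is_subring_def by blast+
      qed
    qed
    moreover have "?Cp \<subseteq> \<Union>\<C>" using ne sub by (fastforce simp: \<A>_def)
    ultimately show "\<Union>\<C> \<in> \<A>" using sub by (auto simp: \<A>_def)
  qed
  then obtain M where M: "M \<in> \<A>" and max: "\<And>X. X \<in> \<A> \<Longrightarrow> M \<subseteq> X \<Longrightarrow> X = M" by blast
  have M': "is_subring M" "?Cp \<subseteq> M" "M \<subseteq> C" "z \<notin> M" using M by (auto simp: \<A>_def)
  \<comment> \<open>\<open>M\<close> contains C^p, hence all (Q p)-th powers, as the exchange
    property requires.\<close>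
  have MQ: "u ^ (Q * p) \<in> M" for u using C(2)[of u] M'(2) by (auto simp: power_mult)
  have p0: "p > 0" using p prime_gt_0_nat by blast
  have "y \<in> adjoin M z" if "y \<in> C" for y
  proof (cases "y \<in> M")
    case False
    have "adjoin M y \<notin> \<A>"
    proof
      assume "adjoin M y \<in> \<A>"
      then have "adjoin M y = M" using adjoin_base[OF M'(1)] by (intro max) auto
      then show False using False adjoin_gen[OF M'(1), of y] by simp
    qed
    moreover have "is_subring (adjoin M y)" using M'(1) by (rule is_subring_adjoin)
    moreover have "?Cp \<subseteq> adjoin M y" using M'(2) adjoin_base[OF M'(1)] by blast
    moreover have "adjoin M y \<subseteq> C" using C(1) M'(3) that by (rule adjoin_least)
    ultimately have zy: "z \<in> adjoin M y" unfolding \<A>_def by blast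
    have "y ^ p \<in> M" using M'(2) that by blast
    then show ?thesis
      using C(3) p0 by (intro adjoin_exchange[OF p M'(1) MQ _ _ zy M'(4)]) simp_all
  qed (use adjoin_base[OF M'(1)] in blast)
  then show ?thesis using M' that[of M] by blast
qed

text \<open>The next ring is cut out of the current one by avoiding the power of x that has just
  become an element of it. This multiplies the degree of x by p while x still generates the whole
  field.\<close>

lemma descending_subring_chain:
  fixes x :: "'a::field"
  assumes p: "prime p" "p = CHAR('a)"
    and C: "is_subring C" "\<And>u. u ^ (p ^ Suc m) \<in> C" "x ^ (p ^ m) \<notin> C" "adjoin C x = UNIV"
    and S: "S \<subseteq> C" "S \<subseteq> (\<lambda>a. a ^ p) ` S"
  obtains M where "M 0 = C" "\<And>n. is_subring (M n)" "\<And>n u. u ^ (p ^ Suc (m + n)) \<in> M n"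
    "\<And>n. x ^ (p ^ (m + n)) \<notin> M n" "\<And>n. adjoin (M n) x = UNIV" "\<And>n. S \<subseteq> M n" "\<And>n. M (Suc n) \<subseteq> M n"
proof -
  \<comment> \<open>The clause for n = 0 fixes the start of the chain, which dependent choice alone
    would leave open.\<close>
  define P where "P = (\<lambda>n M. (n = 0 \<longrightarrow> M = C) \<and> is_subring M \<and> (\<forall>u. u ^ (p ^ Suc (m + n)) \<in> M) \<and>
    x ^ (p ^ (m + n)) \<notin> M \<and> adjoin M x = UNIV \<and> S \<subseteq> M)"
  have "\<exists>M. \<forall>n. P n (M n) \<and> M (Suc n) \<subseteq> M n"
  proof (rule dependent_nat_choice)
    show "\<exists>M. P 0 M" using C S by (intro exI[of _ C]) (auto simp: P_def)
    fix L n assume "P n L"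
    then have L: "is_subring L" "\<And>u. u ^ (p ^ Suc (m + n)) \<in> L" "x ^ (p ^ (m + n)) \<notin> L"
      "adjoin L x = UNIV" "S \<subseteq> L"
      unfolding P_def by blast+
    define z where "z = x ^ (p ^ Suc (m + n))"
    have z: "z \<in> L" unfolding z_def by (rule L(2))
    \<comment> \<open>p-th roots are unique in characteristic p, and the p-th root x^(p^(m+n)) of
      \<open>z\<close> lies outside \<open>L\<close>.\<close>
    have znot: "z \<notin> (\<lambda>a. a ^ p) ` L"
    proof
      assume "z \<in> (\<lambda>a. a ^ p) ` L"
      then obtain a where a: "a \<in> L" "z = a ^ p" by blast
      have "(x ^ (p ^ (m + n)) - a) ^ p + a ^ p = (x ^ (p ^ (m + n)) - a + a) ^ p"
        by (rule freshmans_dream[symmetric]) (use p in auto)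
      also have "\<dots> = z" by (simp add: z_def mult.commute flip: power_mult)
      finally have "(x ^ (p ^ (m + n)) - a) ^ p = 0" using a by simp
      then have "x ^ (p ^ (m + n)) = a" by simp
      then show False using a L(3) by simp
    qed
    have pos: "p ^ Suc (m + n) > 0" using p(1) prime_gt_0_nat by simp
    obtain M where M: "is_subring M" "(\<lambda>a. a ^ p) ` L \<subseteq> M" "M \<subseteq> L" "z \<notin> M" "L \<subseteq> adjoin M z"
      using maximal_subring_avoiding[OF p L(1,2) pos z znot] by blast
    have "u ^ (p ^ Suc (m + Suc n)) \<in> M" for u
    proof -
      have "u ^ (p ^ Suc (m + Suc n)) = (u ^ (p ^ Suc (m + n))) ^ p"
        by (simp add: mult.commute flip: power_mult)
      then show ?thesis using L(2)[of u] M(2) by auto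
    qed
    \<comment> \<open>M(x) contains the power \<open>z\<close> of x, hence contains L = M(z), hence
      L(x).\<close>
    moreover have "adjoin M x = UNIV"
    proof -
      have A: "is_subring (adjoin M x)" using M(1) by (rule is_subring_adjoin)
      have "x \<in> adjoin M x" "M \<subseteq> adjoin M x"
        using adjoin_gen[OF M(1)] adjoin_base[OF M(1)] by auto
      moreover from this(1) have "z \<in> adjoin M x" unfolding z_def by (rule subring_power[OF A])
      ultimately have "L \<subseteq> adjoin M x" using adjoin_least[OF A, of M z] M(5) by blast
      then have "adjoin L x \<subseteq> adjoin M x" using \<open>x \<in> adjoin M x\<close> by (intro adjoin_least A)
      then show ?thesis using L(4) by blast
    qed
    \<comment> \<open>S is contained in S^p, so it survives the passage from \<open>L\<close> to a
      subring that is only known to contain L^p.\<close>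
    moreover have "S \<subseteq> M" using S(2) L(5) M(2) by blast
    ultimately have "P (Suc n) M" using M by (auto simp: P_def z_def)
    then show "\<exists>M. P (Suc n) M \<and> M \<subseteq> L" using M(3) by blast
  qed
  then show ?thesis using that unfolding P_def by metis
qed

section \<open>Iterativity in terms of coefficients\<close>

lemma fps_cutoff_mult_cong:
  assumes "fps_cutoff q A = fps_cutoff q A'" "fps_cutoff q B = fps_cutoff q B'"
  shows "fps_cutoff q (A * B) = fps_cutoff q (A' * B')"
  using assms unfolding fps_cutoff_eq_fps_cutoff_iff by (auto simp: fps_mult_nth intro!: sum.cong)

lemma fps_cutoff_power_cong:
  "fps_cutoff q A = fps_cutoff q A' \<Longrightarrow> fps_cutoff q (A ^ n) = fps_cutoff q (A' ^ n)"
  for A A' :: "'a::comm_ring_1 fps"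
  by (induction n) (auto intro: fps_cutoff_mult_cong)

lemma algebra_map_0: "algebra_map \<phi> \<Longrightarrow> \<phi> 0 = 0"
  unfolding algebra_map_def by (metis add_cancel_right_right)

lemma algebra_map_sum: "algebra_map \<phi> \<Longrightarrow> \<phi> (sum f A) = (\<Sum>i\<in>A. \<phi> (f i))"
  by (induction A rule: infinite_finite_induct) (auto simp: algebra_map_0, auto simp: algebra_map_def)

lemma algebra_map_of_nat: "algebra_map \<phi> \<Longrightarrow> \<phi> (of_nat n) = of_nat n"
  by (induction n) (auto simp: algebra_map_0, auto simp: algebra_map_def)

lemma algebra_map_mult: "algebra_map \<phi> \<Longrightarrow> \<phi> (a * b) = \<phi> a * \<phi> b"
  by (simp add: algebra_map_def)

lemma algebra_map_add: "algebra_map \<phi> \<Longrightarrow> \<phi> (a + b) = \<phi> a + \<phi> b"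
  by (simp add: algebra_map_def)

lemma algebra_map_1: "algebra_map \<phi> \<Longrightarrow> \<phi> 1 = 1"
  by (simp add: algebra_map_def)

lemma algebra_map_power: "algebra_map \<phi> \<Longrightarrow> \<phi> (a ^ n) = \<phi> a ^ n"
  by (induction n) (auto simp: algebra_map_def)

lemmas algebra_map_simps = algebra_map_0 algebra_map_1 algebra_map_add algebra_map_mult
  algebra_map_sum algebra_map_of_nat algebra_map_power

lemma algebra_map_CHAR:
  fixes \<phi> :: "'k::field \<Rightarrow> 'r::field"
  assumes "algebra_map \<phi>" "prime CHAR('k)"
  shows "CHAR('r) = CHAR('k)"
proof -
  have "of_nat CHAR('k) = (0::'r)"
    by (metis algebra_map_0 algebra_map_of_nat assms(1) of_nat_CHAR)
  then have "CHAR('r) dvd CHAR('k)" by (simp add: of_nat_eq_0_iff_char_dvd)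
  moreover have "CHAR('r) \<noteq> 1" by simp
  ultimately show ?thesis using assms(2) by (metis prime_nat_iff)
qed

text \<open>The coefficient of X^i Y^j on both sides of iterativity. Stopping at n < q loses nothing
  when q is a power of the characteristic and F has no constant term
  (\<open>fps2_power_nth_eq_0_prime_char\<close>), so one predicate serves both notions: q = p^m for
  the truncated one, all q = p^N for the full one.\<close>

definition iterative_upto ::
  "nat \<Rightarrow> ('k::comm_ring_1 \<Rightarrow> 'r::comm_ring_1) \<Rightarrow> 'k fps fps \<Rightarrow> (nat \<Rightarrow> 'r \<Rightarrow> 'r) \<Rightarrow> bool" where
  "iterative_upto q \<phi> F D \<longleftrightarrow> truncated_HS_derivation q \<phi> D \<and>
     (\<forall>i<q. \<forall>j<q. \<forall>r. D i (D j r) = (\<Sum>n<q. \<phi> ((F ^ n) $ j $ i) * D n r))"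

lemma fps2_mult_nth:
  "(A * B) $ j $ i = (\<Sum>b\<le>j. \<Sum>a\<le>i. A $ b $ a * B $ (j - b) $ (i - a))"
  for A B :: "'a::comm_ring_1 fps fps"
  by (simp add: fps_mult_nth fps_sum_nth atLeast0AtMost)

lemma coeff_trunc2_power:
  fixes \<phi> :: "'k::comm_ring_1 \<Rightarrow> 'r::comm_ring_1"
  assumes \<phi>: "algebra_map \<phi>" and "i < q" "j < q"
  shows "coeff (coeff (map_poly (map_poly \<phi>) (trunc2 q F) ^ n) j) i = \<phi> ((F ^ n) $ j $ i)"
  using assms(2,3)
proof (induction n arbitrary: i j)
  case 0
  then show ?case using \<phi> by (auto simp: algebra_map_simps coeff_1)
next
  case (Suc n)
  have T: "coeff (coeff (map_poly (map_poly \<phi>) (trunc2 q F)) b) a = \<phi> (F $ b $ a)"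
    if "a < q" "b < q" for a b
    using that \<phi> by (simp add: trunc2_def coeff_map_poly algebra_map_0)
  have "coeff (coeff (map_poly (map_poly \<phi>) (trunc2 q F) ^ Suc n) j) i =
      (\<Sum>b\<le>j. \<Sum>a\<le>i. \<phi> (F $ b $ a) * \<phi> ((F ^ n) $ (j - b) $ (i - a)))"
    unfolding power_Suc coeff_mult coeff_sum
    using Suc.prems by (intro sum.cong refl) (simp add: T Suc.IH)
  also have "\<dots> = \<phi> ((F ^ Suc n) $ j $ i)"
    using \<phi> by (simp add: fps2_mult_nth algebra_map_simps)
  finally show ?case .
qed

lemma trunc_cong_coeff:
  assumes "trunc_cong q A B" "i < q" "j < q"
  shows "coeff (coeff A j) i = coeff (coeff B j) i"
proof -
  obtain U V where "A - B = [:monom 1 q:] * U + monom 1 q * V"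
    using assms(1) unfolding trunc_cong_def by blast
  then have "coeff (coeff (A - B) j) i = coeff (coeff ([:monom 1 q:] * U + monom 1 q * V) j) i"
    by simp
  then show ?thesis using assms by (simp add: coeff_monom_mult)
qed

lemma truncated_F_derivation_imp_iterative_upto:
  fixes \<phi> :: "'k::comm_ring_1 \<Rightarrow> 'r::comm_ring_1"
  assumes "algebra_map \<phi>" "truncated_F_derivation q \<phi> F D"
  shows "iterative_upto q \<phi> F D"
  unfolding iterative_upto_def
proof (intro conjI allI impI)
  show "truncated_HS_derivation q \<phi> D" using assms(2) by (simp add: truncated_F_derivation_def)
  fix i j r assume ij: "i < q" "j < q"
  have "coeff (coeff (\<Sum>i<q. \<Sum>j<q. monom (monom (D i (D j r)) i) j) j) i =
      coeff (coeff (\<Sum>n<q. [:[:D n r:]:] * map_poly (map_poly \<phi>) (trunc2 q F) ^ n) j) i"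
    using assms(2) ij unfolding truncated_F_derivation_def by (intro trunc_cong_coeff[of q]) auto
  also have "\<dots> = (\<Sum>n<q. \<phi> ((F ^ n) $ j $ i) * D n r)"
    using ij by (simp add: coeff_sum coeff_trunc2_power[OF assms(1)] mult.commute)
  also have "coeff (coeff (\<Sum>i<q. \<Sum>j<q. monom (monom (D i (D j r)) i) j) j) i =
      (\<Sum>a<q. \<Sum>b<q. if a = i then if b = j then D i (D j r) else 0 else 0)"
    unfolding coeff_sum by (intro sum.cong refl) auto
  also have "\<dots> = (\<Sum>a<q. if a = i then D i (D j r) else 0)"
    using ij by (intro sum.cong refl) simp
  also have "\<dots> = D i (D j r)" using ij by simp
  finally show "D i (D j r) = (\<Sum>n<q. \<phi> ((F ^ n) $ j $ i) * D n r)" .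
qed

lemma fps2_power_nth_eq_0:
  fixes A :: "'a::comm_ring_1 fps fps"
  assumes "A $ 0 $ 0 = 0" "i + j < n"
  shows "(A ^ n) $ j $ i = 0"
  using assms(2)
proof (induction n arbitrary: i j)
  case (Suc n)
  have "A $ b $ a * (A ^ n) $ (j - b) $ (i - a) = 0" if "a \<le> i" "b \<le> j" for a b
  proof (cases "a + b = 0")
    case False
    then show ?thesis using Suc.prems that by (subst Suc.IH) auto
  qed (use assms(1) in simp)
  then show ?case unfolding power_Suc fps2_mult_nth by (intro sum.neutral ballI) simp
qed simp

text \<open>Write A = X c + Y B. By Frobenius A^q = X^q c^q + Y^q B^q, so A^n lies in the ideal
  (X^q, Y^q) for n >= q.\<close>

lemma fps2_power_nth_eq_0_prime_char:
  fixes A :: "'a::idom fps fps"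
  assumes A: "A $ 0 $ 0 = 0" and p: "prime CHAR('a)" "q = CHAR('a) ^ N"
    and "i < q" "j < q" "q \<le> n"
  shows "(A ^ n) $ j $ i = 0"
proof -
  define c where "c = fps_shift 1 (A $ 0)"
  define B where "B = fps_shift 1 A"
  have "A = fps_const (fps_X * c) + fps_X * B"
  proof (rule fps_ext)
    show "A $ m = (fps_const (fps_X * c) + fps_X * B) $ m" for m
      using A by (cases m) (auto simp: B_def c_def fps_eq_iff)
  qed
  moreover have "(fps_const (fps_X * c) + fps_X * B) ^ q = fps_const (fps_X * c) ^ q + (fps_X * B) ^ q"
    by (rule freshmans_dream') (use p in auto)
  ultimately have Aq: "A ^ q = fps_const (fps_X ^ q * c ^ q) + fps_X ^ q * B ^ q"
    by (simp add: power_mult_distrib)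
  have "A ^ n = (fps_const (fps_X ^ q * c ^ q) + fps_X ^ q * B ^ q) * A ^ (n - q)"
    unfolding Aq[symmetric] using \<open>q \<le> n\<close> by (simp flip: power_add)
  also have "\<dots> = fps_const (fps_X ^ q * c ^ q) * A ^ (n - q) + fps_X ^ q * (B ^ q * A ^ (n - q))"
    by (simp add: algebra_simps)
  also have "\<dots> $ j $ i = 0"
    using assms(4,5) by (simp add: fps_X_power_mult_nth mult.assoc del: fps_const_mult fps_const_power)
  finally show ?thesis .
qed

lemma map_coeffs2_power:
  fixes \<phi> :: "'k::comm_ring_1 \<Rightarrow> 'r::comm_ring_1"
  assumes "algebra_map \<phi>"
  shows "map_coeffs2 \<phi> F ^ n $ j $ i = \<phi> ((F ^ n) $ j $ i)"
proof (induction n arbitrary: i j)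
  case 0
  then show ?case using assms by (auto simp: algebra_map_simps)
next
  case (Suc n)
  then show ?case
    using assms by (simp add: fps2_mult_nth algebra_map_simps) (simp add: map_coeffs2_def)
qed

lemma F_derivationI:
  fixes \<phi> :: "'k::field \<Rightarrow> 'r::comm_ring_1"
  assumes \<phi>: "algebra_map \<phi>" and p: "prime p" and F: "F $ 0 $ 0 = 0"
    and D: "\<And>N. iterative_upto (p ^ N) \<phi> F D"
  shows "F_derivation \<phi> F D"
proof -
  have big: "\<exists>N. n < p ^ N" for n
    using power_gt_expt[of p n] prime_gt_1_nat[OF p] by auto
  have HS: "truncated_HS_derivation (p ^ N) \<phi> D" for N using D by (simp add: iterative_upto_def)
  have "HS_derivation \<phi> D"
    unfolding HS_derivation_def
  proof (intro conjI allI impI)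
    show "D 0 = id" using HS[of 0] by (simp add: truncated_HS_derivation_def)
    fix n x y
    obtain N where "n < p ^ N" using big by blast
    then show "D n (x + y) = D n x + D n y" "D n (x * y) = (\<Sum>i\<le>n. D i x * D (n - i) y)"
      using HS[of N] by (auto simp: truncated_HS_derivation_def)
  next
    fix n c assume "(0::nat) < n"
    moreover obtain N where "n < p ^ N" using big by blast
    ultimately show "D n (\<phi> c) = 0" using HS[of N] by (auto simp: truncated_HS_derivation_def)
  qed
  moreover have "Abs_fps (\<lambda>j. Abs_fps (\<lambda>i. D i (D j r))) =
      subst12 (Abs_fps (\<lambda>n. D n r)) (map_coeffs2 \<phi> F)" for r
  proof (intro fps_ext)
    fix j i :: nat
    \<comment> \<open>Bounding the sum i + j, and not just i and j, lets the range n < p^N be cut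
      down to n <= i + j as in \<open>subst12\<close>.\<close>
    obtain N where N: "i + j < p ^ N" using big by blast
    have "D i (D j r) = (\<Sum>n<p ^ N. \<phi> ((F ^ n) $ j $ i) * D n r)"
      using D[of N] N unfolding iterative_upto_def by simp
    also have "\<dots> = (\<Sum>n\<le>i + j. \<phi> ((F ^ n) $ j $ i) * D n r)"
      using N \<phi> by (intro sum.mono_neutral_right) (auto simp: fps2_power_nth_eq_0[OF F] algebra_map_0)
    finally show "Abs_fps (\<lambda>j. Abs_fps (\<lambda>i. D i (D j r))) $ j $ i =
        subst12 (Abs_fps (\<lambda>n. D n r)) (map_coeffs2 \<phi> F) $ j $ i"
      using \<phi> by (simp add: subst12_def map_coeffs2_power mult.commute)
  qed
  ultimately show ?thesis by (simp add: F_derivation_def)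
qed

section \<open>Transport along homomorphisms\<close>

lemma subst12_nth:
  assumes "A $ 0 $ 0 = 0" "i + j \<le> N"
  shows "subst12 f A $ j $ i = (\<Sum>n\<le>N. f $ n * (A ^ n) $ j $ i)"
proof -
  have "(\<Sum>n\<le>N. f $ n * (A ^ n) $ j $ i) = (\<Sum>n\<le>i + j. f $ n * (A ^ n) $ j $ i)"
    using assms by (intro sum.mono_neutral_right) (auto simp: fps2_power_nth_eq_0)
  then show ?thesis by (simp add: subst12_def)
qed

lemma subst12_mult:
  fixes A :: "'a::comm_ring_1 fps fps"
  assumes A: "A $ 0 $ 0 = 0"
  shows "subst12 (f * g) A = subst12 f A * subst12 g A"
proof (intro fps_ext)
  fix j i :: nat
  define N where "N = i + j"
  \<comment> \<open>A finite sum that agrees with \<open>subst12 f A\<close> up to total degree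
    \<open>N\<close>, so that the product can be expanded and regrouped by n + l.\<close>
  define T where "T = (\<lambda>f. \<Sum>n\<le>N. fps_const (fps_const (f $ n)) * A ^ n)"
  have T: "T f $ b $ a = subst12 f A $ b $ a" if "a + b \<le> N" for f a b
    using that by (simp add: T_def subst12_nth[OF A] fps_sum_nth)
  have "(subst12 f A * subst12 g A) $ j $ i = (T f * T g) $ j $ i"
    unfolding fps2_mult_nth by (intro sum.cong refl) (simp add: T N_def)
  also have "T f * T g = (\<Sum>n\<le>N. \<Sum>l\<le>N. fps_const (fps_const (f $ n * g $ l)) * A ^ (n + l))"
    unfolding T_def sum_product
    by (intro sum.cong refl) (simp add: power_add mult_ac flip: fps_const_mult)
  also have "\<dots> $ j $ i = (\<Sum>n\<le>N. \<Sum>l\<le>N. f $ n * g $ l * (A ^ (n + l)) $ j $ i)"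
    by (simp add: fps_sum_nth)
  also have "\<dots> = (\<Sum>(n, l)\<in>{..N} \<times> {..N}. f $ n * g $ l * (A ^ (n + l)) $ j $ i)"
    by (rule sum.cartesian_product)
  also have "\<dots> = (\<Sum>(n, l)\<in>{(n, l). n + l \<le> N}. f $ n * g $ l * (A ^ (n + l)) $ j $ i)"
  proof (intro sum.mono_neutral_right ballI)
    fix x assume "x \<in> {..N} \<times> {..N} - {(n, l). n + l \<le> N}"
    then show "(case x of (n, l) \<Rightarrow> f $ n * g $ l * (A ^ (n + l)) $ j $ i) = 0"
      by (auto simp: N_def fps2_power_nth_eq_0[OF A] split: prod.split)
  qed auto
  also have "\<dots> = (\<Sum>k\<le>N. \<Sum>n\<le>k. f $ n * g $ (k - n) * (A ^ (n + (k - n))) $ j $ i)"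
    by (rule sum.triangle_reindex_eq)
  also have "\<dots> = (\<Sum>k\<le>N. (f * g) $ k * (A ^ k) $ j $ i)"
    by (simp add: fps_mult_nth sum_distrib_right atLeast0AtMost)
  also have "\<dots> = subst12 (f * g) A $ j $ i"
    by (rule subst12_nth[OF A, symmetric]) (simp add: N_def)
  finally show "subst12 (f * g) A $ j $ i = (subst12 f A * subst12 g A) $ j $ i" by simp
qed

lemma subst12_power:
  fixes A :: "'a::comm_ring_1 fps fps"
  assumes A: "A $ 0 $ 0 = 0"
  shows "subst12 (f ^ n) A = subst12 f A ^ n"
proof (induction n)
  case 0
  show ?case
  proof (intro fps_ext)
    show "subst12 (f ^ 0) A $ j $ i = (subst12 f A ^ 0) $ j $ i" for j i
      using sum.delta[of "{..i + j}" 0 "\<lambda>n. (A ^ n) $ j $ i"]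
      by (simp add: subst12_def mult_delta_left)
  qed
qed (simp add: subst12_mult[OF A])

text \<open>\<open>in_Y b\<close> is \<open>b(Y)\<close>, and \<open>double_subst b F\<close> is \<open>F(b(X), b(Y))\<close>.\<close>

definition in_Y :: "'a::comm_ring_1 fps \<Rightarrow> 'a fps fps" where
  "in_Y b = Abs_fps (\<lambda>j. fps_const (b $ j))"

definition double_subst :: "'a::comm_ring_1 fps \<Rightarrow> 'a fps fps \<Rightarrow> 'a fps fps" where
  "double_subst b F = Abs_fps (\<lambda>c. F $ c oo b) oo in_Y b"

lemma in_Y_mult: "in_Y (f * g) = in_Y f * in_Y g"
  by (intro fps_ext) (simp add: in_Y_def fps_mult_nth fps_sum_nth)

lemma in_Y_power: "in_Y (f ^ n) = in_Y f ^ n"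
proof (induction n)
  case 0
  show ?case by (intro fps_ext) (simp add: in_Y_def)
qed (simp add: in_Y_mult)

lemma double_subst_mult:
  fixes b :: "'a::field fps"
  assumes "b $ 0 = 0"
  shows "double_subst b (F * G) = double_subst b F * double_subst b G"
proof -
  have "Abs_fps (\<lambda>c. (F * G) $ c oo b) = Abs_fps (\<lambda>c. F $ c oo b) * Abs_fps (\<lambda>c. G $ c oo b)"
    by (rule fps_ext)
      (simp add: fps_mult_nth fps_compose_sum_distrib fps_compose_mult_distrib[OF assms])
  then show ?thesis
    unfolding double_subst_def
    using assms by (simp add: fps_compose_mult_distrib in_Y_def)
qed

lemma double_subst_power:
  fixes b :: "'a::field fps"
  assumes "b $ 0 = 0"
  shows "double_subst b (F ^ n) = double_subst b F ^ n"
proof (induction n)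
  case 0
  have "Abs_fps (\<lambda>c. (1 :: 'a fps fps) $ c oo b) = 1" by (rule fps_ext) simp
  then show ?case by (simp add: double_subst_def)
qed (simp add: double_subst_mult[OF assms])

lemma double_subst_nth:
  fixes b :: "'a::field fps"
  assumes "b $ 0 = 0"
  shows "double_subst b F $ j $ i = (\<Sum>c\<le>j. \<Sum>a\<le>i. F $ c $ a * (b ^ a) $ i * (b ^ c) $ j)"
proof -
  have "double_subst b F $ j $ i = (\<Sum>c\<le>j. ((F $ c oo b) * in_Y (b ^ c) $ j) $ i)"
    by (simp add: double_subst_def fps_compose_nth fps_sum_nth in_Y_power atLeast0AtMost)
  then show ?thesis
    by (simp add: in_Y_def fps_compose_nth sum_distrib_right atLeast0AtMost)
qed

text \<open>Expresses the bounded double sum by two library compositions, one per variable. Each of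
  them is multiplicative, which makes powers of F(b(X), b(Y)) accessible.\<close>

lemma subst22_separate:
  fixes b :: "'a::field fps"
  assumes b: "b $ 0 = 0"
  shows "subst22 F (subst12 b X2) (subst12 b Y2) = double_subst b F"
proof -
  have X: "subst12 b X2 = fps_const b"
  proof (intro fps_ext)
    show "subst12 b X2 $ j $ i = fps_const b $ j $ i" for j i
      using sum.delta[of "{..i + j}" i "\<lambda>n. b $ n"]
      by (auto simp: subst12_def mult_delta_right fps_X_power_nth if_distrib cong: if_cong)
  qed
  have Y: "subst12 b Y2 = in_Y b"
  proof (intro fps_ext)
    fix j i :: nat
    have "b $ n * (Y2 ^ n) $ j $ i = (if n = j then if i = 0 then b $ j else 0 else 0)" for n
      by (auto simp: fps_X_power_nth)
    then show "subst12 b Y2 $ j $ i = in_Y b $ j $ i" by (simp add: subst12_def in_Y_def)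
  qed
  show ?thesis
  proof (intro fps_ext)
    fix j i :: nat
    have "subst22 F (subst12 b X2) (subst12 b Y2) $ j $ i =
        (\<Sum>a\<le>i + j. \<Sum>c\<le>i + j. F $ c $ a * (b ^ a) $ i * (b ^ c) $ j)"
      unfolding subst22_def X Y
      by (simp flip: in_Y_power) (simp add: in_Y_def mult.assoc)
    also have "\<dots> = (\<Sum>a\<le>i. \<Sum>c\<le>i + j. F $ c $ a * (b ^ a) $ i * (b ^ c) $ j)"
      using b by (intro sum.mono_neutral_right) (auto simp: startsby_zero_power_prefix)
    also have "\<dots> = (\<Sum>a\<le>i. \<Sum>c\<le>j. F $ c $ a * (b ^ a) $ i * (b ^ c) $ j)"
      using b by (intro sum.cong refl sum.mono_neutral_right) (auto simp: startsby_zero_power_prefix)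
    also have "\<dots> = double_subst b F $ j $ i"
      unfolding double_subst_nth[OF b] by (rule sum.swap)
    finally show "subst22 F (subst12 b X2) (subst12 b Y2) $ j $ i = double_subst b F $ j $ i" .
  qed
qed

text \<open>Compares coefficients of X^i Y^j in the n-th power of b(G(X,Y)) = F(b(X), b(Y)).\<close>

lemma fgl_hom_power_nth:
  fixes b :: "'a::field fps"
  assumes "fgl_hom G F b" "G $ 0 $ 0 = 0"
  shows "(\<Sum>l\<le>i + j. (b ^ n) $ l * (G ^ l) $ j $ i) =
    (\<Sum>c\<le>j. \<Sum>a\<le>i. (F ^ n) $ c $ a * (b ^ a) $ i * (b ^ c) $ j)"
proof -
  have b: "b $ 0 = 0" and "subst12 b G = double_subst b F"
    using assms(1) by (auto simp: fgl_hom_def subst22_separate)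
  then have "subst12 (b ^ n) G = double_subst b (F ^ n)"
    by (simp add: subst12_power assms(2) double_subst_power)
  then have "subst12 (b ^ n) G $ j $ i = double_subst b (F ^ n) $ j $ i" by simp
  then show ?thesis unfolding double_subst_nth[OF b] by (simp add: subst12_def)
qed

text \<open>The coefficient of X^i after substituting b(X) for T in the series of all D_n(r) T^n;
  for b without constant term, powers beyond the i-th do not contribute.\<close>

definition transport ::
  "('k::comm_ring_1 \<Rightarrow> 'r::comm_ring_1) \<Rightarrow> 'k fps \<Rightarrow> (nat \<Rightarrow> 'r \<Rightarrow> 'r) \<Rightarrow> nat \<Rightarrow> 'r \<Rightarrow> 'r" where
  "transport \<phi> b D i r = (\<Sum>n\<le>i. \<phi> ((b ^ n) $ i) * D n r)"

definition map_fps :: "('k \<Rightarrow> 'r) \<Rightarrow> 'k fps \<Rightarrow> 'r fps" where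
  "map_fps \<phi> f = Abs_fps (\<lambda>n. \<phi> (f $ n))"

lemma map_fps_nth [simp]: "map_fps \<phi> f $ n = \<phi> (f $ n)"
  by (simp add: map_fps_def)

lemma map_fps_power:
  fixes \<phi> :: "'k::comm_ring_1 \<Rightarrow> 'r::comm_ring_1"
  assumes "algebra_map \<phi>"
  shows "map_fps \<phi> (f ^ n) = map_fps \<phi> f ^ n"
proof (induction n)
  case 0
  then show ?case using assms by (auto simp: fps_eq_iff algebra_map_simps)
next
  case (Suc n)
  have "map_fps \<phi> (f ^ Suc n) = map_fps \<phi> f * map_fps \<phi> (f ^ n)"
    using assms by (intro fps_ext) (simp add: fps_mult_nth algebra_map_simps)
  with Suc show ?case by simp
qed

lemma map_fps_compose:
  fixes \<phi> :: "'k::comm_ring_1 \<Rightarrow> 'r::comm_ring_1"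
  assumes "algebra_map \<phi>"
  shows "map_fps \<phi> (f oo g) = map_fps \<phi> f oo map_fps \<phi> g"
  using assms
  by (intro fps_ext) (simp add: fps_compose_nth algebra_map_simps flip: map_fps_power)

lemma transport_conv_compose:
  fixes \<phi> :: "'k::comm_ring_1 \<Rightarrow> 'r::comm_ring_1"
  assumes "algebra_map \<phi>"
  shows "transport \<phi> b D n r = (Abs_fps (\<lambda>n. D n r) oo map_fps \<phi> b) $ n"
  using assms
  by (simp add: transport_def fps_compose_nth atLeast0AtMost mult.commute flip: map_fps_power)

lemma fps_cutoff_compose_cong:
  "fps_cutoff q A = fps_cutoff q A' \<Longrightarrow> fps_cutoff q (A oo b) = fps_cutoff q (A' oo b)"
  unfolding fps_cutoff_eq_fps_cutoff_iff by (auto simp: fps_compose_nth intro!: sum.cong)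

lemma truncated_HS_derivation_mult:
  assumes "truncated_HS_derivation q \<phi> D"
  shows "fps_cutoff q (Abs_fps (\<lambda>n. D n (x * y))) =
    fps_cutoff q (Abs_fps (\<lambda>n. D n x) * Abs_fps (\<lambda>n. D n y))"
  using assms
  by (simp add: fps_cutoff_eq_fps_cutoff_iff truncated_HS_derivation_def fps_mult_nth atLeast0AtMost)

lemma truncated_HS_derivation_scale:
  assumes D: "truncated_HS_derivation q \<phi> D" and c: "\<And>n. 0 < n \<Longrightarrow> n < q \<Longrightarrow> D n c = 0" and n: "n < q"
  shows "D n (c * y) = c * D n y"
proof -
  have "D n (c * y) = (\<Sum>i\<le>n. D i c * D (n - i) y)"
    using D n by (auto simp: truncated_HS_derivation_def)
  also have "\<dots> = (\<Sum>i\<in>{0}. D i c * D (n - i) y)"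
    using n c by (intro sum.mono_neutral_right) auto
  finally show ?thesis using D by (simp add: truncated_HS_derivation_def)
qed

lemma truncated_HS_derivation_0:
  fixes D :: "nat \<Rightarrow> 'r::comm_ring_1 \<Rightarrow> 'r"
  assumes "truncated_HS_derivation q \<phi> D" "n < q"
  shows "D n 0 = 0"
  using assms unfolding truncated_HS_derivation_def by (metis add_cancel_right_right)

lemma truncated_HS_derivation_sum:
  fixes D :: "nat \<Rightarrow> 'r::comm_ring_1 \<Rightarrow> 'r"
  assumes "truncated_HS_derivation q \<phi> D" "n < q"
  shows "D n (sum f A) = (\<Sum>a\<in>A. D n (f a))"
proof (induction A rule: infinite_finite_induct)
  case (insert x A)
  then show ?case using assms by (simp add: truncated_HS_derivation_def)
qed (simp_all add: truncated_HS_derivation_0[OF assms])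

lemma truncated_HS_derivation_transport:
  fixes \<phi> :: "'k::field \<Rightarrow> 'r::field"
  assumes \<phi>: "algebra_map \<phi>" and b: "b $ 0 = 0" and D: "truncated_HS_derivation q \<phi> D"
  shows "truncated_HS_derivation q \<phi> (transport \<phi> b D)"
  unfolding truncated_HS_derivation_def
proof (intro conjI allI impI)
  let ?b = "map_fps \<phi> b"
  have b0: "?b $ 0 = 0" using b \<phi> by (simp add: algebra_map_0)
  show "transport \<phi> b D 0 = id"
    using D \<phi> by (auto simp: transport_def truncated_HS_derivation_def algebra_map_1)
  fix n x y assume n: "n < q"
  show "transport \<phi> b D n (x + y) = transport \<phi> b D n x + transport \<phi> b D n y"
    using D n by (simp add: transport_def truncated_HS_derivation_def distrib_left sum.distrib)
  have "fps_cutoff q (Abs_fps (\<lambda>n. D n (x * y)) oo ?b) =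
      fps_cutoff q ((Abs_fps (\<lambda>n. D n x) * Abs_fps (\<lambda>n. D n y)) oo ?b)"
    using D by (intro fps_cutoff_compose_cong truncated_HS_derivation_mult)
  then have "transport \<phi> b D n (x * y) =
      ((Abs_fps (\<lambda>n. D n x) * Abs_fps (\<lambda>n. D n y)) oo ?b) $ n"
    using n by (simp add: transport_conv_compose[OF \<phi>] fps_cutoff_eq_fps_cutoff_iff)
  also have "\<dots> = ((Abs_fps (\<lambda>n. D n x) oo ?b) * (Abs_fps (\<lambda>n. D n y) oo ?b)) $ n"
    using b0 by (simp add: fps_compose_mult_distrib)
  also have "\<dots> = (\<Sum>i\<le>n. transport \<phi> b D i x * transport \<phi> b D (n - i) y)"
    by (simp add: fps_mult_nth transport_conv_compose[OF \<phi>] atLeast0AtMost)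
  finally show "transport \<phi> b D n (x * y) = (\<Sum>i\<le>n. transport \<phi> b D i x * transport \<phi> b D (n - i) y)" .
next
  fix n c assume n: "0 < n \<and> n < q"
  have "\<phi> ((b ^ i) $ n) * D i (\<phi> c) = 0" if "i \<le> n" for i
    using D n that \<phi> by (cases "i = 0") (auto simp: truncated_HS_derivation_def algebra_map_0)
  then show "transport \<phi> b D n (\<phi> c) = 0"
    unfolding transport_def by (intro sum.neutral ballI) simp
qed

text \<open>Transport is contravariant. With D_T(r) for the series of all D_n(r) T^n, iterativity
  along F gives D_b(X) D_b(Y) = D_F(b(X),b(Y)), and this is D_b(G(X,Y)) because b is a homomorphism
  from G to F.\<close>

lemma iterative_upto_transport:
  fixes \<phi> :: "'k::field \<Rightarrow> 'r::field"
  assumes \<phi>: "algebra_map \<phi>" and p: "prime CHAR('k)" "q = CHAR('k) ^ N"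
    and hom: "fgl_hom G F b" and G: "G $ 0 $ 0 = 0" and D: "iterative_upto q \<phi> F D"
  shows "iterative_upto q \<phi> G (transport \<phi> b D)"
proof -
  have b: "b $ 0 = 0" using hom by (simp add: fgl_hom_def)
  have HS: "truncated_HS_derivation q \<phi> D" using D by (simp add: iterative_upto_def)
  have lin: "D a (\<phi> c * y) = \<phi> c * D a y" if "a < q" for a c y
    using HS that by (intro truncated_HS_derivation_scale[OF HS]) (auto simp: truncated_HS_derivation_def)
  have "transport \<phi> b D i (transport \<phi> b D j r) = (\<Sum>l<q. \<phi> ((G ^ l) $ j $ i) * transport \<phi> b D l r)"
    if ij: "i < q" "j < q" for i j r
  proof -
    \<comment> \<open>Both ranges are compared with l <= i + j + q: terms beyond i + j vanish by
      order, terms from q on by Frobenius.\<close>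
    have range: "(\<Sum>l\<le>i + j. (b ^ n) $ l * (G ^ l) $ j $ i) = (\<Sum>l<q. (b ^ n) $ l * (G ^ l) $ j $ i)" for n
    proof -
      have "(\<Sum>l\<le>i + j. (b ^ n) $ l * (G ^ l) $ j $ i) = (\<Sum>l\<le>i + j + q. (b ^ n) $ l * (G ^ l) $ j $ i)"
        by (intro sum.mono_neutral_left) (auto simp: fps2_power_nth_eq_0[OF G])
      also have "\<dots> = (\<Sum>l<q. (b ^ n) $ l * (G ^ l) $ j $ i)"
        using fps2_power_nth_eq_0_prime_char[OF G p ij]
        by (intro sum.mono_neutral_right) auto
      finally show ?thesis .
    qed
    have "transport \<phi> b D i (transport \<phi> b D j r) =
        (\<Sum>a\<le>i. \<Sum>c\<le>j. \<phi> ((b ^ a) $ i) * (\<phi> ((b ^ c) $ j) * D a (D c r)))"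
      unfolding transport_def sum_distrib_left
      using ij by (intro sum.cong refl) (simp add: truncated_HS_derivation_sum[OF HS] lin sum_distrib_left)
    also have "\<dots> = (\<Sum>a\<le>i. \<Sum>c\<le>j. \<Sum>n<q. \<phi> ((F ^ n) $ c $ a * (b ^ a) $ i * (b ^ c) $ j) * D n r)"
      using ij D by (intro sum.cong refl)
        (simp add: iterative_upto_def sum_distrib_left algebra_map_mult[OF \<phi>] mult_ac)
    also have "\<dots> = (\<Sum>a\<le>i. \<Sum>n<q. \<Sum>c\<le>j. \<phi> ((F ^ n) $ c $ a * (b ^ a) $ i * (b ^ c) $ j) * D n r)"
      by (intro sum.cong refl sum.swap)
    also have "\<dots> = (\<Sum>n<q. \<Sum>a\<le>i. \<Sum>c\<le>j. \<phi> ((F ^ n) $ c $ a * (b ^ a) $ i * (b ^ c) $ j) * D n r)"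
      by (rule sum.swap)
    also have "\<dots> = (\<Sum>n<q. \<Sum>c\<le>j. \<Sum>a\<le>i. \<phi> ((F ^ n) $ c $ a * (b ^ a) $ i * (b ^ c) $ j) * D n r)"
      by (intro sum.cong refl sum.swap)
    also have "\<dots> = (\<Sum>n<q. \<phi> (\<Sum>c\<le>j. \<Sum>a\<le>i. (F ^ n) $ c $ a * (b ^ a) $ i * (b ^ c) $ j) * D n r)"
      by (simp add: algebra_map_sum[OF \<phi>] sum_distrib_right)
    also have "\<dots> = (\<Sum>n<q. \<phi> (\<Sum>l\<le>i + j. (b ^ n) $ l * (G ^ l) $ j $ i) * D n r)"
      by (simp add: fgl_hom_power_nth[OF hom G])
    also have "\<dots> = (\<Sum>n<q. \<phi> (\<Sum>l<q. (b ^ n) $ l * (G ^ l) $ j $ i) * D n r)"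
      by (simp only: range)
    also have "\<dots> = (\<Sum>n<q. \<Sum>l<q. \<phi> ((G ^ l) $ j $ i) * (\<phi> ((b ^ n) $ l) * D n r))"
      by (simp add: algebra_map_sum[OF \<phi>] algebra_map_mult[OF \<phi>] sum_distrib_left sum_distrib_right mult_ac)
    also have "(\<Sum>n<q. \<Sum>l<q. \<phi> ((G ^ l) $ j $ i) * (\<phi> ((b ^ n) $ l) * D n r)) =
        (\<Sum>l<q. \<Sum>n<q. \<phi> ((G ^ l) $ j $ i) * (\<phi> ((b ^ n) $ l) * D n r))"
      by (rule sum.swap)
    also have "\<dots> = (\<Sum>l<q. \<phi> ((G ^ l) $ j $ i) * (\<Sum>n<q. \<phi> ((b ^ n) $ l) * D n r))"
      by (simp add: sum_distrib_left)
    also have "\<dots> = (\<Sum>l<q. \<phi> ((G ^ l) $ j $ i) * transport \<phi> b D l r)"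
      unfolding transport_def using b \<phi>
      by (intro sum.cong refl arg_cong2[of _ _ _ _ "(*)"] sum.mono_neutral_right)
         (auto simp: startsby_zero_power_prefix algebra_map_0)
    finally show ?thesis .
  qed
  then show ?thesis
    unfolding iterative_upto_def using truncated_HS_derivation_transport[OF \<phi> b HS] by blast
qed

text \<open>Agreement of \<open>D'\<close> with the transported sequence is asked only up to n,
  because the integrated derivation matches the given one only below p^m.\<close>

lemma transport_transport:
  fixes \<phi> :: "'k::field \<Rightarrow> 'r::field"
  assumes \<phi>: "algebra_map \<phi>" and ab: "a $ 0 = 0" "b $ 0 = 0" "b oo a = fps_X"
    and D': "\<And>i. i \<le> n \<Longrightarrow> D' i = transport \<phi> b D i"
  shows "transport \<phi> a D' n = D n"
proof
  fix r
  have 0: "map_fps \<phi> a $ 0 = 0" "map_fps \<phi> b $ 0 = 0" using ab \<phi> by (simp_all add: algebra_map_0)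
  have "map_fps \<phi> b oo map_fps \<phi> a = map_fps \<phi> fps_X"
    by (simp add: ab(3) flip: map_fps_compose[OF \<phi>])
  also have "\<dots> = fps_X" using \<phi> by (auto simp: fps_eq_iff fps_X_def algebra_map_simps)
  finally have X: "map_fps \<phi> b oo map_fps \<phi> a = fps_X" .
  have "Abs_fps (\<lambda>m. transport \<phi> b D m r) = Abs_fps (\<lambda>m. D m r) oo map_fps \<phi> b"
    by (rule fps_ext) (simp add: transport_conv_compose[OF \<phi>])
  moreover have "transport \<phi> a D' n r = transport \<phi> a (transport \<phi> b D) n r"
    using D' by (simp add: transport_def[of \<phi> a])
  ultimately have "transport \<phi> a D' n r = ((Abs_fps (\<lambda>n. D n r) oo map_fps \<phi> b) oo map_fps \<phi> a) $ n"
    by (simp add: transport_conv_compose[OF \<phi>, of a])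
  also have "\<dots> = D n r"
    using X 0 by (simp add: fps_compose_assoc[symmetric])
  finally show "transport \<phi> a D' n r = D n r" .
qed

section \<open>The additive and multiplicative laws\<close>

text \<open>The parameter e interpolates between the additive law (e = 0) and the multiplicative law
  (e = 1), so that most arguments treat both at once.\<close>

definition model_fgl :: "'a::comm_ring_1 \<Rightarrow> 'a fps fps" where
  "model_fgl e = X2 + Y2 + fps_const (fps_const e) * X2 * Y2"

lemma model_fgl_0_0: "model_fgl e $ 0 $ 0 = 0"
  by (simp add: model_fgl_def)

text \<open>In the outer variable the model law is the linear polynomial (1 + e X) Y + X, so this
  gives its powers.\<close>

lemma linear_in_Y_power_nth:
  fixes u v :: "'a::comm_ring_1 fps"
  shows "((fps_const u * fps_X + fps_const v) ^ n) $ j = of_nat (n choose j) * (u ^ j * v ^ (n - j))"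
proof -
  have "((fps_const u * fps_X + fps_const v) ^ n) $ j =
      (\<Sum>k\<le>n. (of_nat (n choose k) * (fps_const u * fps_X) ^ k * fps_const v ^ (n - k)) $ j)"
    by (simp add: binomial_ring fps_sum_nth)
  also have "\<dots> = (\<Sum>k\<le>n. if k = j then of_nat (n choose k) * (u ^ k * v ^ (n - k)) else 0)"
  proof (intro sum.cong refl)
    fix k
    have "of_nat (n choose k) * (fps_const u * fps_X) ^ k * fps_const v ^ (n - k) =
        fps_X ^ k * fps_const (of_nat (n choose k) * (u ^ k * v ^ (n - k)))"
      by (simp add: power_mult_distrib fps_of_nat mult_ac flip: fps_const_mult fps_of_nat)
    then show "(of_nat (n choose k) * (fps_const u * fps_X) ^ k * fps_const v ^ (n - k)) $ j =
        (if k = j then of_nat (n choose k) * (u ^ k * v ^ (n - k)) else 0)"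
      by (simp add: fps_X_power_mult_nth)
  qed
  also have "\<dots> = of_nat (n choose j) * (u ^ j * v ^ (n - j))"
    by (cases "j \<le> n") (simp_all add: binomial_eq_0)
  finally show ?thesis .
qed

lemma model_fgl_power_nth:
  "(model_fgl e ^ n) $ j = of_nat (n choose j) * ((1 + fps_const e * fps_X) ^ j * fps_X ^ (n - j))"
proof -
  have "model_fgl e = fps_const (1 + fps_const e * fps_X) * fps_X + fps_const fps_X"
    by (simp add: model_fgl_def algebra_simps flip: fps_const_add fps_const_mult)
  then show ?thesis by (simp only: linear_in_Y_power_nth)
qed

lemma of_nat_mult_fps_nth: "(of_nat c * f) $ n = of_nat c * f $ n"
  for f :: "'a::comm_ring_1 fps"
  by (simp flip: fps_of_nat)

text \<open>The coefficients of the recursion D_1 D_j = j e D_j + (j + 1) D_(j+1).\<close>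

lemma model_fgl_power_nth_1:
  "(model_fgl e ^ n) $ j $ 1 = (if n = j then of_nat j * e else if n = Suc j then of_nat (Suc j) else 0)"
proof -
  have lin: "((1 + fps_const e * fps_X) ^ j) $ 0 = 1"
    "((1 + fps_const e * fps_X) ^ j) $ 1 = of_nat j * e" for j
    by (induction j) (simp_all add: fps_mult_nth algebra_simps)
  consider "n < j" | "n = j" | "n = Suc j" | "n > Suc j" by linarith
  then show ?thesis
  proof cases
    case 1
    then show ?thesis by (simp add: model_fgl_power_nth binomial_eq_0)
  next
    case 2
    then show ?thesis using lin[of j] by (simp add: model_fgl_power_nth)
  next
    case 3
    have "(model_fgl e ^ Suc j) $ j $ 1 = of_nat (Suc j) * ((1 + fps_const e * fps_X) ^ j * fps_X ^ 1) $ 1"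
      unfolding model_fgl_power_nth of_nat_mult_fps_nth by (simp del: of_nat_Suc)
    also have "\<dots> = of_nat (Suc j)"
      unfolding fps_X_power_mult_right_nth using lin(1)[of j] by simp
    finally show ?thesis using 3 by simp
  next
    case 4
    then show ?thesis
      by (simp add: model_fgl_power_nth of_nat_mult_fps_nth fps_X_power_mult_right_nth)
  qed
qed

text \<open>Frobenius together with e^p = e gives F(X,Y)^p = F(X^p,Y^p), hence F(X,Y)^(p n) =
  F(X^p,Y^p)^n.\<close>

lemma model_fgl_power_prime_nth:
  fixes e :: "'k::field"
  assumes p: "prime CHAR('k)" "p = CHAR('k)" and e: "e ^ p = e"
  shows "(model_fgl e ^ (p * n)) $ j $ i =
    (if p dvd i \<and> p dvd j then (model_fgl e ^ n) $ (j div p) $ (i div p) else 0)"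
proof -
  let ?X = "fps_X :: 'k fps" and ?l = "1 + fps_const e * fps_X"
  have p0: "p > 0" using p prime_gt_0_nat by simp
  have add: "(a + b) ^ p = a ^ p + b ^ p" for a b :: "'k fps"
    by (rule freshmans_dream) (use p in auto)
  have add2: "(a + b) ^ p = a ^ p + b ^ p" for a b :: "'k fps fps"
    by (rule freshmans_dream) (use p in auto)
  have lp: "?l ^ p = 1 + fps_const e * ?X ^ p" by (simp add: add power_mult_distrib e)
  have Xp: "(?X ^ p) $ 0 = 0" using p0 by simp
  have comp: "(?l ^ b * ?X ^ c) oo ?X ^ p = (?l ^ p) ^ b * ?X ^ (p * c)" for b c
    using Xp by (simp add: fps_compose_mult_distrib fps_compose_power fps_compose_add_distrib lp
      flip: fps_compose_power power_mult)
  have "model_fgl e = fps_const ?l * fps_X + fps_const fps_X"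
    by (simp add: model_fgl_def algebra_simps flip: fps_const_add fps_const_mult)
  then have "model_fgl e ^ (p * n) = ((fps_const ?l * fps_X + fps_const fps_X) ^ p) ^ n"
    by (simp only: power_mult)
  also have "(fps_const ?l * fps_X + fps_const fps_X) ^ p =
      fps_const (?l ^ p) * fps_X ^ p + fps_const (?X ^ p)"
    by (simp add: add2 power_mult_distrib)
  \<comment> \<open>Passing to p-th powers of the variables is written as a composition, for the
    outer variable here and for the inner one below.\<close>
  also have "\<dots> = (fps_const (?l ^ p) * fps_X + fps_const (?X ^ p)) oo fps_X ^ p"
    using p0 by (simp add: fps_compose_add_distrib fps_compose_mult_distrib)
  also have "\<dots> ^ n = ((fps_const (?l ^ p) * fps_X + fps_const (?X ^ p)) ^ n) oo fps_X ^ p"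
    using p0 by (simp add: fps_compose_power)
  finally have "(model_fgl e ^ (p * n)) $ j = (if p dvd j then
      of_nat (n choose (j div p)) * ((?l ^ p) ^ (j div p) * ?X ^ (p * (n - j div p))) else 0)"
    by (simp add: fps_nth_compose_X_power linear_in_Y_power_nth flip: power_mult)
  also have "\<dots> = (if p dvd j then (model_fgl e ^ n) $ (j div p) oo ?X ^ p else 0)"
  proof -
    have "(model_fgl e ^ n) $ b oo ?X ^ p = of_nat (n choose b) * ((?l ^ p) ^ b * ?X ^ (p * (n - b)))" for b
      unfolding model_fgl_power_nth fps_compose_mult_distrib[OF Xp, of "of_nat _"] comp
      by (simp flip: fps_of_nat)
    then show ?thesis by simp
  qed
  finally show ?thesis by (simp add: fps_nth_compose_X_power)
qed

section \<open>Derivations whose first component vanishes\<close>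

lemma sum_lessThan_multiples:
  fixes f :: "nat \<Rightarrow> 'a::comm_monoid_add"
  assumes "p > 0" "\<And>n. n < p * M \<Longrightarrow> \<not> p dvd n \<Longrightarrow> f n = 0"
  shows "sum f {..<p * M} = (\<Sum>n<M. f (p * n))"
proof -
  have "sum f {..<p * M} = sum f ((*) p ` {..<M})"
  proof (intro sum.mono_neutral_right ballI)
    fix i assume "i \<in> {..<p * M} - (*) p ` {..<M}"
    then show "f i = 0" using assms by (cases "p dvd i") (auto elim!: dvdE)
  qed (use assms(1) in auto)
  also have "\<dots> = (\<Sum>n<M. f (p * n))"
    using assms(1) by (subst sum.reindex) (auto simp: inj_on_def)
  finally show ?thesis .
qed

lemma sum_atMost_multiples:
  fixes f :: "nat \<Rightarrow> 'a::comm_monoid_add"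
  assumes "p > 0" "\<And>n. n \<le> p * M \<Longrightarrow> \<not> p dvd n \<Longrightarrow> f n = 0"
  shows "sum f {..p * M} = (\<Sum>n\<le>M. f (p * n))"
proof -
  have "sum f {..p * M} = sum f ((*) p ` {..M})"
  proof (intro sum.mono_neutral_right ballI)
    fix i assume "i \<in> {..p * M} - (*) p ` {..M}"
    then show "f i = 0" using assms by (cases "p dvd i") (auto elim!: dvdE)
  qed (use assms(1) in auto)
  also have "\<dots> = (\<Sum>n\<le>M. f (p * n))"
    using assms(1) by (subst sum.reindex) (auto simp: inj_on_def)
  finally show ?thesis .
qed

text \<open>With D_1 = 0 the recursion reads j e D_j + (j + 1) D_(j+1) = 0, and j + 1 is invertible
  when p does not divide it.\<close>

lemma iterative_upto_eq_0_if_not_dvd: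
  fixes \<phi> :: "'k::field \<Rightarrow> 'r::field"
  assumes \<phi>: "algebra_map \<phi>" and p: "prime p" "p = CHAR('k)"
    and D: "iterative_upto q \<phi> (model_fgl e) D" and 1: "D 1 = (\<lambda>_. 0)"
  shows "n < q \<Longrightarrow> \<not> p dvd n \<Longrightarrow> D n r = 0"
proof (induction n)
  case (Suc j)
  have char: "CHAR('r) = p" using algebra_map_CHAR[OF \<phi>] p by simp
  show ?case
  proof (cases "j = 0")
    case False
    then have "1 < q" "j < q" using Suc.prems by auto
    then have "D 1 (D j r) = (\<Sum>n<q. \<phi> ((model_fgl e ^ n) $ j $ 1) * D n r)"
      using D unfolding iterative_upto_def by blast
    also have "\<dots> = (\<Sum>n<q. (if n = j then of_nat j * \<phi> e * D j r else 0) +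
        (if n = Suc j then of_nat (Suc j) * D (Suc j) r else 0))"
      unfolding model_fgl_power_nth_1
      by (intro sum.cong refl) (auto simp: algebra_map_simps[OF \<phi>] simp del: of_nat_Suc)
    also have "\<dots> = of_nat j * \<phi> e * D j r + of_nat (Suc j) * D (Suc j) r"
      using Suc.prems by (simp add: sum.distrib del: of_nat_Suc)
    \<comment> \<open>Either j = 0 in K, or D_j vanishes by induction.\<close>
    also have "of_nat j * \<phi> e * D j r = 0"
    proof (cases "p dvd j")
      case True
      then have "of_nat j = (0 :: 'r)" using char by (simp add: of_nat_eq_0_iff_char_dvd)
      then show ?thesis by simp
    next
      case False
      then show ?thesis using Suc by simp
    qed
    finally have "of_nat (Suc j) * D (Suc j) r = 0" using 1 by simp
    moreover have "of_nat (Suc j) \<noteq> (0 :: 'r)"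
      using Suc.prems char by (simp only: of_nat_eq_0_iff_char_dvd) simp
    ultimately show ?thesis by (metis mult_eq_0_iff)
  qed (use 1 in simp)
qed simp

text \<open>The relation at indices p i and p j has nonzero terms only at indices p n, and its
  coefficients there are those at i, j and n.\<close>

lemma iterative_upto_contract:
  fixes \<phi> :: "'k::field \<Rightarrow> 'r::field"
  assumes \<phi>: "algebra_map \<phi>" and p: "prime p" "p = CHAR('k)" and e: "e ^ p = e"
    and D: "iterative_upto (p * q) \<phi> (model_fgl e) D"
    and 0: "\<And>n r. n < p * q \<Longrightarrow> \<not> p dvd n \<Longrightarrow> D n r = 0"
  shows "iterative_upto q \<phi> (model_fgl e) (\<lambda>n. D (p * n))"
proof -
  have p0: "p > 0" using p prime_gt_0_nat by simp
  have pk: "prime CHAR('k)" using p by simp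
  note frob = model_fgl_power_prime_nth[OF pk p(2) e]
  have less: "p * n < p * q" if "n < q" for n using p0 that by simp
  have HS: "truncated_HS_derivation (p * q) \<phi> D" using D by (simp add: iterative_upto_def)
  have "D (p * n) (x * y) = (\<Sum>i\<le>n. D (p * i) x * D (p * (n - i)) y)" if "n < q" for n x y
  proof -
    have "D (p * n) (x * y) = (\<Sum>i\<le>p * n. D i x * D (p * n - i) y)"
      using HS less[OF that] by (simp add: truncated_HS_derivation_def)
    also have "\<dots> = (\<Sum>i\<le>n. D (p * i) x * D (p * n - p * i) y)"
    proof (intro sum_atMost_multiples p0)
      fix i assume "i \<le> p * n" "\<not> p dvd i"
      then have "D i x = 0" using less[OF that] by (intro 0 le_less_trans[of i "p * n"])
      then show "D i x * D (p * n - i) y = 0" by simp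
    qed
    finally show ?thesis by (simp add: diff_mult_distrib2)
  qed
  then have "truncated_HS_derivation q \<phi> (\<lambda>n. D (p * n))"
    using HS less p0 by (auto simp: truncated_HS_derivation_def)
  moreover have "D (p * i) (D (p * j) r) = (\<Sum>n<q. \<phi> ((model_fgl e ^ n) $ j $ i) * D (p * n) r)"
    if "i < q" "j < q" for i j r
  proof -
    have "D (p * i) (D (p * j) r) = (\<Sum>n<p * q. \<phi> ((model_fgl e ^ n) $ (p * j) $ (p * i)) * D n r)"
      using D less that by (simp add: iterative_upto_def)
    also have "\<dots> = (\<Sum>n<q. \<phi> ((model_fgl e ^ (p * n)) $ (p * j) $ (p * i)) * D (p * n) r)"
      by (intro sum_lessThan_multiples p0) (simp add: 0)
    finally show ?thesis
      using p0 by (simp add: frob)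
  qed
  ultimately show ?thesis by (simp add: iterative_upto_def)
qed

text \<open>Undoes the contraction by filling in zeros. The bound q need not grow, since the result
  is applied to a sequence that is iterative up to every power of p.\<close>

lemma iterative_upto_expand:
  fixes \<phi> :: "'k::field \<Rightarrow> 'r::field"
  assumes \<phi>: "algebra_map \<phi>" and p: "prime p" "p = CHAR('k)" and e: "e ^ p = e"
    and q: "q = p ^ N"
    and D: "iterative_upto q \<phi> (model_fgl e) D"
  shows "iterative_upto q \<phi> (model_fgl e) (\<lambda>n. if p dvd n then D (n div p) else (\<lambda>_. 0))"
    (is "iterative_upto q \<phi> _ ?E")
proof -
  have p0: "p > 0" using p prime_gt_0_nat by simp
  have pk: "prime CHAR('k)" using p by simp
  note frob = model_fgl_power_prime_nth[OF pk p(2) e]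
  have HS: "truncated_HS_derivation q \<phi> D" using D by (simp add: iterative_upto_def)
  have le: "n div p < q" if "n < q" for n using that by (meson div_le_dividend le_less_trans)
  have "?E n (x * y) = (\<Sum>i\<le>n. ?E i x * ?E (n - i) y)" if n: "n < q" for n x y
  proof (cases "p dvd n")
    case True
    then obtain k where k: "n = p * k" by (elim dvdE)
    have "(\<Sum>i\<le>n. ?E i x * ?E (n - i) y) = (\<Sum>i\<le>k. ?E (p * i) x * ?E (p * k - p * i) y)"
      unfolding k by (intro sum_atMost_multiples p0) simp
    also have "\<dots> = (\<Sum>i\<le>k. D i x * D (k - i) y)"
      using p0 by (intro sum.cong refl) (simp flip: diff_mult_distrib2)
    also have "\<dots> = D k (x * y)" using HS le[OF n] k p0 by (simp add: truncated_HS_derivation_def)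
    finally show ?thesis using k p0 by simp
  next
    case False
    have "?E i x * ?E (n - i) y = 0" if "i \<le> n" for i
      using False dvd_add[of p i "n - i"] that by auto
    then have "(\<Sum>i\<le>n. ?E i x * ?E (n - i) y) = 0" by (intro sum.neutral) blast
    then show ?thesis using False by simp
  qed
  moreover have "?E n (\<phi> c) = 0" if "0 < n" "n < q" for n c
    using HS le[OF that(2)] that by (auto simp: truncated_HS_derivation_def elim!: dvdE)
  ultimately have "truncated_HS_derivation q \<phi> ?E"
    using HS le unfolding truncated_HS_derivation_def by auto
  moreover have "?E i (?E j r) = (\<Sum>n<q. \<phi> ((model_fgl e ^ n) $ j $ i) * ?E n r)"
    if ij: "i < q" "j < q" for i j r
  proof -
    \<comment> \<open>Allows the range n < q to be lengthened to n < p q, which splits evenly into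
      multiples of p.\<close>
    have "(model_fgl e ^ n) $ j $ i = 0" if "q \<le> n" for n
      using fps2_power_nth_eq_0_prime_char[OF model_fgl_0_0 pk _ ij that] q p(2) by simp
    then have "(\<Sum>n<q. \<phi> ((model_fgl e ^ n) $ j $ i) * ?E n r) =
        (\<Sum>n<p * q. \<phi> ((model_fgl e ^ n) $ j $ i) * ?E n r)"
      using p0 \<phi>
      by (intro sum.mono_neutral_left) (auto simp: algebra_map_0)
    also have "\<dots> = (\<Sum>n<q. \<phi> ((model_fgl e ^ (p * n)) $ j $ i) * ?E (p * n) r)"
      by (intro sum_lessThan_multiples p0) simp
    also have "\<dots> = (\<Sum>n<q. (if p dvd i \<and> p dvd j then
        \<phi> ((model_fgl e ^ n) $ (j div p) $ (i div p)) * D n r else 0))"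
      using p0 \<phi> by (intro sum.cong refl) (auto simp: frob algebra_map_0)
    also have "\<dots> = (if p dvd i \<and> p dvd j then D (i div p) (D (j div p) r) else 0)"
      using D le ij by (cases "p dvd i \<and> p dvd j") (auto simp: iterative_upto_def)
    also have "\<dots> = ?E i (?E j r)"
      using truncated_HS_derivation_0[OF HS le[OF ij(1)]] by auto
    finally show ?thesis by simp
  qed
  ultimately show ?thesis by (simp add: iterative_upto_def)
qed

section \<open>Coordinates for a truncated derivation\<close>

definition series_of :: "(nat \<Rightarrow> 'r \<Rightarrow> 'r) \<Rightarrow> 'r \<Rightarrow> 'r fps" where
  "series_of D y = Abs_fps (\<lambda>n. D n y)"

lemma series_of_nth [simp]: "series_of D y $ n = D n y"
  by (simp add: series_of_def)

definition constants_upto :: "nat \<Rightarrow> (nat \<Rightarrow> 'r::comm_ring_1 \<Rightarrow> 'r) \<Rightarrow> 'r set" where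
  "constants_upto q D = {c. \<forall>n. 0 < n \<and> n < q \<longrightarrow> D n c = 0}"

text \<open>f - a is divisible by X, so its n-th power starts at X^n with the n-th power of the
  linear coefficient.\<close>

lemma shift_power_nth:
  fixes f :: "'a::comm_ring_1 fps"
  assumes "f $ 0 = a"
  shows "((f - fps_const a) ^ n * g) $ n = (f $ 1) ^ n * g $ 0"
proof -
  have "f - fps_const a = fps_X * fps_shift 1 f"
  proof (rule fps_ext)
    show "(f - fps_const a) $ k = (fps_X * fps_shift 1 f) $ k" for k
      using assms by (cases k) auto
  qed
  then have "(f - fps_const a) ^ n * g = fps_X ^ n * (fps_shift 1 f ^ n * g)"
    by (simp add: power_mult_distrib mult.assoc)
  moreover have "(fps_shift 1 f ^ n * g) $ 0 = (f $ 1) ^ n * g $ 0"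
    by (simp add: fps_power_zeroth)
  ultimately show ?thesis by (simp add: fps_X_power_mult_nth)
qed

text \<open>Makes x + \<open>slope e x\<close> X the image of x under translation by X or scaling by
  1 + X, the actions that obey the two model laws.\<close>

definition slope :: "'k::zero \<Rightarrow> 'r::one \<Rightarrow> 'r" where
  "slope e x = (if e = 0 then 1 else x)"

text \<open>Two polynomials over M with the same value at x differ by a multiple of (T - x)^Q, Q =
  p^(N+1), and T = x + g X turns this factor into (g X)^Q.\<close>

lemma coeff_pcompose_eq_if_poly_eq:
  fixes x :: "'a::field"
  assumes p: "prime p" "p = CHAR('a)"
    and M: "is_subring M" "\<And>u. u ^ (p ^ Suc N) \<in> M" "x ^ (p ^ Suc N) \<in> M" "x ^ (p ^ N) \<notin> M"
    and h: "h \<in> polys_over M" "h' \<in> polys_over M" "poly h x = poly h' x" and n: "n < p ^ Suc N"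
  shows "coeff (pcompose h [:x, g:]) n = coeff (pcompose h' [:x, g:]) n"
proof -
  define Q where "Q = p ^ Suc N"
  have "[:- x, 1:] ^ Q dvd h - h'"
    unfolding Q_def
  proof (rule root_over_subfield_dvd[OF p M(1) _ M(3,4)])
    show "inverse a \<in> M" if "a \<in> M" for a
      using prime_gt_0_nat[OF p(1)] that by (intro subring_inverse[OF M(1,2)]) auto
    show "h - h' \<in> polys_over M" using h by (intro subring_diff is_subring_polys_over M(1))
  qed (use h in simp)
  then obtain s where "h - h' = [:- x, 1:] ^ Q * s" by (elim dvdE)
  then have "pcompose h [:x, g:] - pcompose h' [:x, g:] = pcompose ([:- x, 1:] ^ Q) [:x, g:] * pcompose s [:x, g:]"
    by (simp flip: pcompose_diff pcompose_mult)
  also have "pcompose ([:- x, 1:] ^ Q) [:x, g:] = monom (g ^ Q) Q"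
  proof -
    have "pcompose (f ^ k) r = pcompose f r ^ k" for f r :: "'a poly" and k
      by (induction k) (simp_all add: pcompose_mult pcompose_1)
    moreover have "pcompose [:- x, 1:] [:x, g:] = monom g 1"
      by (simp add: pcompose_pCons monom_altdef)
    ultimately show ?thesis by (simp add: monom_power)
  qed
  finally have "coeff (pcompose h [:x, g:] - pcompose h' [:x, g:]) n = 0"
    using n by (simp add: coeff_monom_mult Q_def)
  then show ?thesis by simp
qed

lemma pcompose_monom_1: "pcompose (monom 1 a) r = r ^ a"
  for r :: "'a::comm_ring_1 poly"
  by (induction a) (simp_all add: monom_Suc pcompose_pCons monom_0 pcompose_1)

section \<open>Binomial identities for the two laws\<close>

lemma additive_model_power_nth:
  "(model_fgl 0 ^ n) $ j $ i = (if n = i + j then of_nat (n choose j) else 0)"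
proof (cases "j \<le> n")
  case True
  then show ?thesis by (auto simp: model_fgl_power_nth of_nat_mult_fps_nth fps_X_power_nth)
qed (simp add: model_fgl_power_nth binomial_eq_0)

lemma choose_iterated: "(a choose j) * ((a - j) choose i) = ((i + j) choose j) * (a choose (i + j))"
proof (cases "i + j \<le> a")
  case True
  then show ?thesis using choose_mult[of j "i + j" a] by (simp add: mult.commute)
next
  case False
  then show ?thesis by (cases "j \<le> a") (auto simp: binomial_eq_0)
qed

lemma one_plus_fps_X_power_nth: "((1 + fps_X) ^ n) $ k = of_nat (n choose k)"
  for n k :: nat
proof (induction n arbitrary: k)
  case (Suc n)
  then show ?case by (cases k) (simp_all add: distrib_right add.commute)
qed (auto simp: binomial_eq_0)

text \<open>The coefficient of X^i Y^j in (1 + F)^a = (1 + X)^a (1 + Y)^a.\<close>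

lemma multiplicative_model_binomial:
  "(\<Sum>n\<le>a. of_nat (a choose n) * (model_fgl 1 ^ n) $ j $ i) =
    (of_nat (a choose j) * of_nat (a choose i) :: 'a::comm_ring_1)"
proof -
  have "(\<Sum>n\<le>a. of_nat (a choose n) * (model_fgl 1 ^ n) $ j $ i) =
      (\<Sum>n\<le>a. of_nat (a choose n) * model_fgl (1::'a) ^ n * 1 ^ (a - n)) $ j $ i"
    by (simp add: fps_sum_nth of_nat_mult_fps_nth)
  also have "(\<Sum>n\<le>a. of_nat (a choose n) * model_fgl (1::'a) ^ n * 1 ^ (a - n)) = (model_fgl 1 + 1) ^ a"
    by (rule binomial_ring[symmetric])
  also have "model_fgl 1 + 1 = fps_const (1 + fps_X) * (1 + fps_X :: 'a fps fps)"
    by (simp add: model_fgl_def algebra_simps flip: fps_const_add)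
  also have "\<dots> ^ a $ j = of_nat (a choose j) * (1 + fps_X) ^ a"
    by (simp add: power_mult_distrib one_plus_fps_X_power_nth mult.commute)
  also have "\<dots> $ i = of_nat (a choose j) * of_nat (a choose i)"
    by (simp only: of_nat_mult_fps_nth one_plus_fps_X_power_nth)
  finally show ?thesis .
qed

text \<open>The exponent of q is \<open>Suc m\<close> here, so this \<open>m\<close> is one less
  than the exponent m of the overview, and the degree of x over the n-th field is p^(m+n+1).\<close>

context
  fixes \<phi> :: "'k::field \<Rightarrow> 'r::field" and p m q :: nat and e :: 'k and \<delta> :: "nat \<Rightarrow> 'r \<Rightarrow> 'r"
  assumes \<phi>: "algebra_map \<phi>" and p: "prime p" "p = CHAR('k)" and q: "q = p ^ Suc m"
    and e: "e = 0 \<or> e = 1" and \<delta>: "iterative_upto q \<phi> (model_fgl e) \<delta>"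
begin

lemma char_r: "CHAR('r) = p"
  using algebra_map_CHAR[OF \<phi>] p by simp

lemma q_ge_2: "q \<ge> 2"
proof -
  have "p ^ 1 \<le> q" unfolding q using prime_gt_0_nat[OF p(1)] by (intro power_increasing) simp_all
  then show ?thesis using prime_ge_2_nat[OF p(1)] by simp
qed

lemma HS: "truncated_HS_derivation q \<phi> \<delta>"
  using \<delta> by (simp add: iterative_upto_def)

lemma \<delta>_0 [simp]: "\<delta> 0 y = y"
  using HS by (simp add: truncated_HS_derivation_def)

lemma iterate: "i < q \<Longrightarrow> j < q \<Longrightarrow>
    \<delta> i (\<delta> j r) = (\<Sum>n<q. \<phi> ((model_fgl e ^ n) $ j $ i) * \<delta> n r)"
  using \<delta> unfolding iterative_upto_def by blast

lemma series_mult: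
  "fps_cutoff q (series_of \<delta> (x * y)) = fps_cutoff q (series_of \<delta> x * series_of \<delta> y)"
  unfolding series_of_def by (rule truncated_HS_derivation_mult[OF HS])

lemma constants_iff:
  "c \<in> constants_upto q \<delta> \<longleftrightarrow> fps_cutoff q (series_of \<delta> c) = fps_cutoff q (fps_const c)"
  unfolding constants_upto_def fps_cutoff_eq_fps_cutoff_iff by auto

lemma base_constant: "\<phi> c \<in> constants_upto q \<delta>"
  using HS by (auto simp: constants_upto_def truncated_HS_derivation_def)

lemma series_power:
  "fps_cutoff q (series_of \<delta> (y ^ n)) = fps_cutoff q (series_of \<delta> y ^ n)"
proof (induction n)
  case 0
  show ?case using base_constant[of 1] \<phi> by (simp add: constants_iff algebra_map_1)
next
  case (Suc n)
  have "fps_cutoff q (series_of \<delta> (y ^ Suc n)) = fps_cutoff q (series_of \<delta> y * series_of \<delta> (y ^ n))"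
    by (simp add: series_mult)
  also have "\<dots> = fps_cutoff q (series_of \<delta> y * series_of \<delta> y ^ n)"
    using Suc by (intro fps_cutoff_mult_cong) auto
  finally show ?case by simp
qed

lemma is_subring_constants: "is_subring (constants_upto q \<delta>)"
  unfolding is_subring_def
proof (intro conjI ballI)
  let ?C = "constants_upto q \<delta>"
  show "0 \<in> ?C" "1 \<in> ?C"
    using base_constant[of 0] base_constant[of 1] \<phi> by (simp_all add: algebra_map_simps)
  show add: "a + b \<in> ?C" if "a \<in> ?C" "b \<in> ?C" for a b
    using that HS by (auto simp: constants_upto_def truncated_HS_derivation_def)
  show mult: "a * b \<in> ?C" if "a \<in> ?C" "b \<in> ?C" for a b
  proof -
    have "fps_cutoff q (series_of \<delta> (a * b)) = fps_cutoff q (fps_const a * fps_const b)"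
      unfolding series_mult using that by (intro fps_cutoff_mult_cong) (simp_all only: constants_iff)
    then show ?thesis by (simp add: constants_iff)
  qed
  show "- a \<in> ?C" if "a \<in> ?C" for a
  proof -
    \<comment> \<open>\<open>algebra_map\<close> speaks of sums and products only, so negation is
      obtained as multiplication by the constant \<phi>(-1).\<close>
    have "\<phi> (- 1) + 1 = 0" using \<phi> by (metis add.left_inverse algebra_map_0 algebra_map_1 algebra_map_add)
    then have "\<phi> (- 1) = - 1" by (simp add: eq_neg_iff_add_eq_0)
    then show ?thesis using mult[OF base_constant[of "- 1"] that] by simp
  qed
qed

text \<open>Frobenius: (u + X s)^q = u^q + X^q s^q. By \<open>subring_inverse\<close> the constants
  therefore form a subfield.\<close>

lemma power_q_constant: "u ^ q \<in> constants_upto q \<delta>"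
proof -
  define s where "s = fps_shift 1 (series_of \<delta> u)"
  have "series_of \<delta> u = fps_const u + fps_X * s"
  proof (rule fps_ext)
    show "series_of \<delta> u $ n = (fps_const u + fps_X * s) $ n" for n
      by (cases n) (auto simp: s_def)
  qed
  moreover have "(fps_const u + fps_X * s) ^ q = fps_const u ^ q + (fps_X * s) ^ q"
    by (rule freshmans_dream'[where n = "Suc m"]) (use p char_r q in auto)
  ultimately have "series_of \<delta> u ^ q = fps_const (u ^ q) + fps_X ^ q * s ^ q"
    by (simp add: power_mult_distrib)
  then have "fps_cutoff q (series_of \<delta> u ^ q) = fps_cutoff q (fps_const (u ^ q))"
    by (simp add: fps_cutoff_eq_fps_cutoff_iff fps_X_power_mult_nth)
  then show ?thesis by (simp add: constants_iff series_power)
qed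

lemma scale: "c \<in> constants_upto q \<delta> \<Longrightarrow> n < q \<Longrightarrow> \<delta> n (c * y) = c * \<delta> n y"
  by (rule truncated_HS_derivation_scale[OF HS]) (auto simp: constants_upto_def)

lemma shifted_power_series_nth:
  assumes "k < q"
  shows "((series_of \<delta> y - fps_const y) ^ n * series_of \<delta> z) $ k =
    (\<Sum>i\<le>n. of_nat (n choose i) * (- y) ^ (n - i) * \<delta> k (y ^ i * z))"
proof -
  have "(series_of \<delta> y - fps_const y) ^ n = (series_of \<delta> y + fps_const (- y)) ^ n"
    by (simp only: diff_conv_add_uminus fps_const_neg)
  also have "\<dots> * series_of \<delta> z =
      (\<Sum>i\<le>n. fps_const (of_nat (n choose i) * (- y) ^ (n - i)) * (series_of \<delta> y ^ i * series_of \<delta> z))"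
    unfolding binomial_ring sum_distrib_right
    by (intro sum.cong refl) (simp add: fps_const_power mult_ac flip: fps_of_nat fps_const_mult)
  also have "\<dots> $ k = (\<Sum>i\<le>n. of_nat (n choose i) * (- y) ^ (n - i) * \<delta> k (y ^ i * z))"
    unfolding fps_sum_nth
  proof (intro sum.cong refl)
    fix i
    have "fps_cutoff q (series_of \<delta> (y ^ i * z)) = fps_cutoff q (series_of \<delta> y ^ i * series_of \<delta> z)"
      unfolding series_mult by (intro fps_cutoff_mult_cong series_power refl)
    then show "(fps_const (of_nat (n choose i) * (- y) ^ (n - i)) * (series_of \<delta> y ^ i * series_of \<delta> z)) $ k =
        of_nat (n choose i) * (- y) ^ (n - i) * \<delta> k (y ^ i * z)"
      using assms by (simp add: fps_cutoff_eq_fps_cutoff_iff)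
  qed
  finally show ?thesis .
qed

text \<open>The coefficient of \<open>X^(q-1)\<close> in \<open>(\<delta>(y) - y)^(q-1) \<delta>(z)\<close>, computed in two ways.\<close>

lemma top_component_expansion:
  "(\<delta> 1 y) ^ (q - 1) * z =
    (\<Sum>i\<le>q - 1. of_nat ((q - 1) choose i) * (- y) ^ (q - 1 - i) * \<delta> (q - 1) (y ^ i * z))"
  using shift_power_nth[of "series_of \<delta> y" y "q - 1" "series_of \<delta> z"]
    shifted_power_series_nth[of "q - 1" y "q - 1" z] q_ge_2 by simp

text \<open>For z = 1 the expansion writes \<delta>_1(y)^(q-1) as a combination of values of
  \<delta>_(q-1).\<close>

lemma top_component_nonzero:
  assumes "\<delta> 1 \<noteq> (\<lambda>_. 0)"
  obtains y where "\<delta> (q - 1) y \<noteq> 0"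
proof -
  obtain y where "\<delta> 1 y \<noteq> 0" using assms by blast
  then have "(\<delta> 1 y) ^ (q - 1) * 1 \<noteq> 0" by simp
  then obtain i where "\<delta> (q - 1) (y ^ i * 1) \<noteq> 0"
    unfolding top_component_expansion by (metis (no_types, lifting) mult_zero_right sum.neutral)
  then show ?thesis by (rule that)
qed

text \<open>Among the powers F^l with l < q, only l = q - 1 reaches Y^(q-1), so the values of
  \<delta>_(q-1) are eigenvectors of every component.\<close>

lemma iterate_top:
  assumes "n < q"
  shows "\<delta> n (\<delta> (q - 1) y) = \<phi> (((1 + fps_const e * fps_X) ^ (q - 1)) $ n) * \<delta> (q - 1) y"
proof -
  have "\<delta> n (\<delta> (q - 1) y) = (\<Sum>l<q. \<phi> ((model_fgl e ^ l) $ (q - 1) $ n) * \<delta> l y)"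
    using assms by (intro iterate) auto
  also have "\<dots> = (\<Sum>l\<in>{q - 1}. \<phi> ((model_fgl e ^ l) $ (q - 1) $ n) * \<delta> l y)"
    using q_ge_2 \<phi> by (intro sum.mono_neutral_right)
      (auto simp: model_fgl_power_nth binomial_eq_0 algebra_map_0)
  finally show ?thesis by (simp add: model_fgl_power_nth)
qed

text \<open>By Frobenius (1 + X)^q = 1 + X^q, so (1 + X)^(q-1) inverts 1 + X modulo X^q.\<close>

lemma one_plus_X_power: "fps_cutoff q ((1 + fps_X) ^ (q - 1) * (1 + fps_X :: 'r fps)) = fps_cutoff q 1"
proof -
  have "(1 + fps_X) ^ (q - 1) * (1 + fps_X) = (1 + fps_X :: 'r fps) ^ q"
    using q_ge_2 by (metis One_nat_def Suc_1 Suc_le_lessD Suc_lessD Suc_pred mult.commute power_Suc)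
  also have "\<dots> = 1 ^ q + fps_X ^ q"
    by (rule freshmans_dream'[where n = "Suc m"]) (use p char_r q in auto)
  finally have "(1 + fps_X) ^ (q - 1) * (1 + fps_X) = (1 + fps_X ^ q :: 'r fps)" by (simp only: power_one)
  then show ?thesis unfolding fps_cutoff_eq_fps_cutoff_iff by (simp only:) (simp add: fps_X_power_nth)
qed

lemma series_top_multiplicative:
  assumes "e = 1"
  shows "fps_cutoff q (series_of \<delta> (\<delta> (q - 1) y)) =
    fps_cutoff q (fps_const (\<delta> (q - 1) y) * (1 + fps_X) ^ (q - 1))"
proof -
  have "map_fps \<phi> (1 + fps_X) = 1 + fps_X"
    using \<phi> by (auto simp: fps_eq_iff algebra_map_simps fps_X_def)
  then have "map_fps \<phi> ((1 + fps_X) ^ (q - 1)) = (1 + fps_X) ^ (q - 1)"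
    by (simp add: map_fps_power[OF \<phi>])
  then have "\<phi> (((1 + fps_X) ^ (q - 1)) $ n) = ((1 + fps_X) ^ (q - 1)) $ n" for n
    by (metis map_fps_nth)
  then show ?thesis
    using iterate_top assms by (simp add: fps_cutoff_eq_fps_cutoff_iff mult.commute)
qed

text \<open>Let w = \<delta>_(q-1)(y) be nonzero. For the additive law w is constant and \<delta>_1
  \<delta>_(q-2) = -\<delta>_(q-1), so x = -\<delta>_(q-2)(y) / w works. For the multiplicative law
  \<delta>(w) = w / (1 + X) modulo X^q, so x = 1/w works.\<close>

lemma coordinate:
  assumes "\<delta> 1 \<noteq> (\<lambda>_. 0)"
  obtains x where "x \<noteq> 0" "fps_cutoff q (series_of \<delta> x) = fps_cutoff q (fps_const x + fps_const (slope e x) * fps_X)"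
proof -
  obtain y where y: "\<delta> (q - 1) y \<noteq> 0" using top_component_nonzero[OF assms] .
  define w where "w = \<delta> (q - 1) y"
  show ?thesis
  proof (cases "e = 0")
    case True
    have wC: "w \<in> constants_upto q \<delta>"
      using iterate_top[of _ y] True \<phi> by (auto simp: constants_upto_def w_def algebra_map_0)
    \<comment> \<open>The sign compensates for the factor q - 1 = -1 in K.\<close>
    define u where "u = - inverse w"
    have uw: "u * - w = 1" using y by (simp add: u_def w_def)
    have "u \<in> constants_upto q \<delta>"
      using subring_inverse[OF is_subring_constants power_q_constant _ wC] q_ge_2 is_subring_constants
      by (auto simp: is_subring_def u_def)
    note sc = scale[OF this]
    define x where "x = u * \<delta> (q - 2) y"
    have q2: "q - 1 = Suc (q - 2)" using q_ge_2 by simp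
    \<comment> \<open>For e = 0 only l = n + q - 2 contributes to the coefficient of X^n Y^(q-2),
      and l < q then forces n = 1.\<close>
    have it: "\<delta> n (\<delta> (q - 2) y) = (if n = 1 then - w else 0)" if n: "0 < n" "n < q" for n
    proof -
      have "\<delta> n (\<delta> (q - 2) y) = (\<Sum>l<q. \<phi> ((model_fgl e ^ l) $ (q - 2) $ n) * \<delta> l y)"
        using n by (intro iterate) auto
      also have "\<dots> = (\<Sum>l\<in>{q - 1}. \<phi> ((model_fgl e ^ l) $ (q - 2) $ n) * \<delta> l y)"
      proof (intro sum.mono_neutral_right ballI)
        fix l assume l: "l \<in> {..<q} - {q - 1}"
        then consider "l < q - 2" | "l = q - 2" by force
        then have "(model_fgl e ^ l) $ (q - 2) $ n = 0"
          using True n by cases (simp_all add: model_fgl_power_nth binomial_eq_0)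
        then show "\<phi> ((model_fgl e ^ l) $ (q - 2) $ n) * \<delta> l y = 0" using \<phi> by (simp add: algebra_map_0)
      qed (use q_ge_2 in auto)
      also have "\<dots> = (if n = 1 then of_nat (q - 1) * w else 0)"
        using True \<phi> unfolding model_fgl_power_nth q2 w_def
        by (simp add: of_nat_mult_fps_nth algebra_map_simps del: of_nat_Suc)
      also have "of_nat (q - 1) = (- 1 :: 'r)"
      proof -
        have "p dvd q" by (simp add: q)
        then have "(of_nat q :: 'r) = 0" by (simp add: of_nat_eq_0_iff_char_dvd char_r)
        then show ?thesis using q_ge_2 by (simp add: of_nat_diff)
      qed
      finally show ?thesis by simp
    qed
    have x: "\<delta> n x = (if n = 1 then 1 else 0)" if "0 < n" "n < q" for n
      using that uw by (simp add: x_def sc it)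
    have "x \<noteq> 0"
      using x[of 1] truncated_HS_derivation_0[OF HS, of 1] q_ge_2 by auto
    moreover have "fps_cutoff q (series_of \<delta> x) = fps_cutoff q (fps_const x + fps_const (slope e x) * fps_X)"
      unfolding fps_cutoff_eq_fps_cutoff_iff
    proof (intro allI impI)
      show "series_of \<delta> x $ n = (fps_const x + fps_const (slope e x) * fps_X) $ n" if "n < q" for n
        using x[of n] that True by (cases "n = 0") (auto simp: slope_def fps_X_def)
    qed
    ultimately show ?thesis by (rule that)
  next
    case False
    then have e1: "e = 1" using e by simp
    let ?u = "1 + fps_X :: 'r fps"
    define x where "x = inverse w"
    have w0: "w \<noteq> 0" using y by (simp add: w_def)
    have "fps_cutoff q (fps_const 1 * (fps_const x * ?u)) = fps_cutoff q (series_of \<delta> (x * w) * (fps_const x * ?u))"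
      using base_constant[of 1] \<phi> w0
      by (intro fps_cutoff_mult_cong refl) (simp add: x_def constants_iff algebra_map_1)
    also have "\<dots> = fps_cutoff q (series_of \<delta> x * (fps_const w * ?u ^ (q - 1)) * (fps_const x * ?u))"
      unfolding series_mult[of x w]
      using series_top_multiplicative[OF e1, of y]
      by (intro fps_cutoff_mult_cong series_mult[THEN trans] refl) (simp_all add: w_def)
    also have "series_of \<delta> x * (fps_const w * ?u ^ (q - 1)) * (fps_const x * ?u) =
        series_of \<delta> x * (?u ^ (q - 1) * ?u)"
    proof -
      have "fps_const w * fps_const x = 1" using w0 by (simp add: x_def)
      then show ?thesis by (metis (no_types, lifting) mult.assoc mult.commute mult.left_commute mult_1)
    qed
    also have "fps_cutoff q \<dots> = fps_cutoff q (series_of \<delta> x * 1)"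
      by (intro fps_cutoff_mult_cong one_plus_X_power refl)
    finally have "fps_cutoff q (series_of \<delta> x) = fps_cutoff q (fps_const x + fps_const (slope e x) * fps_X)"
      using False by (simp add: slope_def algebra_simps)
    moreover have "x \<noteq> 0" using w0 by (simp add: x_def)
    ultimately show ?thesis by (rule that[rotated])
  qed
qed

section \<open>The action on a coordinate and its extension\<close>

context
  fixes x :: 'r
  assumes x0: "x \<noteq> 0"
    and x: "fps_cutoff q (series_of \<delta> x) = fps_cutoff q (fps_const x + fps_const (slope e x) * fps_X)"
begin

lemma slope_nonzero: "slope e x \<noteq> 0"
  using x0 by (simp add: slope_def)

lemma \<delta>_1_x: "\<delta> 1 x = slope e x"
  using x q_ge_2 by (auto simp: fps_cutoff_eq_fps_cutoff_iff dest!: spec[of _ 1])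

text \<open>In the multiplicative case x scales by 1 + X and \<delta>_(q-1)(y) by its inverse modulo
  X^q, so the product is invariant.\<close>

lemma trace_constant: "slope e x * \<delta> (q - 1) y \<in> constants_upto q \<delta>"
proof (cases "e = 0")
  case True
  then show ?thesis
    using iterate_top[of _ y] \<phi> by (auto simp: constants_upto_def slope_def algebra_map_0)
next
  case False
  then have e1: "e = 1" using e by simp
  let ?w = "\<delta> (q - 1) y" and ?u = "1 + fps_X :: 'r fps"
  have "fps_cutoff q (series_of \<delta> (x * ?w)) = fps_cutoff q ((fps_const x * ?u) * (fps_const ?w * ?u ^ (q - 1)))"
    unfolding series_mult
    using x False by (intro fps_cutoff_mult_cong series_top_multiplicative e1) (simp add: slope_def algebra_simps)
  also have "(fps_const x * ?u) * (fps_const ?w * ?u ^ (q - 1)) = fps_const (x * ?w) * (?u ^ (q - 1) * ?u)"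
    by (simp only: fps_const_mult[symmetric] mult_ac)
  also have "fps_cutoff q \<dots> = fps_cutoff q (fps_const (x * ?w) * 1)"
    by (intro fps_cutoff_mult_cong one_plus_X_power refl)
  finally show ?thesis using False by (simp add: constants_iff slope_def)
qed

text \<open>The expansion for x, multiplied by one more factor g, writes g^q y as a polynomial in x
  whose coefficients g \<delta>_(q-1)(x^i y) are constant up to integer factors; g^q is an
  invertible constant.\<close>

lemma adjoin_constants: "adjoin (constants_upto q \<delta>) x = UNIV"
proof -
  let ?C = "constants_upto q \<delta>"
  let ?A = "adjoin ?C x"
  have A: "is_subring ?A" by (rule is_subring_adjoin[OF is_subring_constants])
  have CA: "c \<in> ?A" if "c \<in> ?C" for c using that by (rule adjoin_base[OF is_subring_constants])
  have xA: "- x \<in> ?A" using A adjoin_gen[OF is_subring_constants, of x] by (auto simp: is_subring_def)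
  have "y \<in> ?A" for y
  proof -
    have "slope e x ^ q * y = slope e x * ((\<delta> 1 x) ^ (q - 1) * y)"
      using q_ge_2 power_minus_mult[of q "slope e x"] by (simp add: \<delta>_1_x[simplified One_nat_def] mult_ac)
    also have "\<dots> = (\<Sum>i\<le>q - 1. of_nat ((q - 1) choose i) * (- x) ^ (q - 1 - i) * (slope e x * \<delta> (q - 1) (x ^ i * y)))"
      unfolding top_component_expansion sum_distrib_left by (simp add: mult_ac)
    also have "\<dots> \<in> ?A"
    proof (intro subring_sum[OF A])
      fix i
      show "of_nat ((q - 1) choose i) * (- x) ^ (q - 1 - i) * (slope e x * \<delta> (q - 1) (x ^ i * y)) \<in> ?A"
        using subring_of_nat[OF A] subring_power[OF A xA] CA[OF trace_constant] A
        unfolding is_subring_def by blast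
    qed
    finally have "slope e x ^ q * y \<in> ?A" .
    moreover have "inverse (slope e x ^ q) \<in> ?A"
      using subring_inverse[OF is_subring_constants power_q_constant _ power_q_constant] q_ge_2 CA by simp
    ultimately have "inverse (slope e x ^ q) * (slope e x ^ q * y) \<in> ?A" using A unfolding is_subring_def by blast
    then show ?thesis using slope_nonzero by (simp flip: mult.assoc)
  qed
  then show ?thesis by blast
qed

text \<open>By Frobenius (x + g X)^P = x^P + g^P X^P for P = p^m < q, so x^P has a nonzero component
  of index P.\<close>

lemma power_not_constant: "x ^ (p ^ m) \<notin> constants_upto q \<delta>"
proof
  assume C: "x ^ (p ^ m) \<in> constants_upto q \<delta>"
  define P where "P = p ^ m"
  have P: "0 < P" "P < q"
    using prime_gt_0_nat[OF p(1)] prime_gt_1_nat[OF p(1)] by (auto simp: q P_def)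
  have "(fps_const x + fps_const (slope e x) * fps_X) ^ P = fps_const x ^ P + (fps_const (slope e x) * fps_X) ^ P"
    by (rule freshmans_dream'[where n = m]) (use p char_r in \<open>auto simp: P_def\<close>)
  also have "\<dots> $ P = slope e x ^ P"
    using P by (simp add: power_mult_distrib fps_X_power_nth)
  finally have "((fps_const x + fps_const (slope e x) * fps_X) ^ P) $ P = slope e x ^ P" .
  moreover have "fps_cutoff q (series_of \<delta> (x ^ P)) = fps_cutoff q ((fps_const x + fps_const (slope e x) * fps_X) ^ P)"
    using fps_cutoff_power_cong[OF x] by (simp only: series_power)
  ultimately have "\<delta> P (x ^ P) = slope e x ^ P"
    using P(2) unfolding fps_cutoff_eq_fps_cutoff_iff by simp
  moreover have "\<delta> P (x ^ P) = 0" using C P by (simp add: constants_upto_def P_def)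
  ultimately show False using slope_nonzero by simp
qed

text \<open>Below q the given \<delta> is itself the substitution over the largest field of the
  chain, which is why the construction below extends it.\<close>

lemma \<delta>_poly:
  assumes "h \<in> polys_over (constants_upto q \<delta>)" "n < q"
  shows "\<delta> n (poly h x) = coeff (pcompose h [:x, slope e x:]) n"
proof -
  have "\<delta> n (poly h x) = (\<Sum>i\<le>degree h. coeff h i * \<delta> n (x ^ i))"
    unfolding poly_altdef truncated_HS_derivation_sum[OF HS assms(2)]
    using assms by (intro sum.cong refl scale) (auto simp: polys_over_def)
  also have "\<dots> = (\<Sum>i\<le>degree h. coeff h i * coeff ([:x, slope e x:] ^ i) n)"
  proof (intro sum.cong refl arg_cong[where f = "(*) _"])
    fix i
    have "fps_const x + fps_const (slope e x) * fps_X = fps_of_poly [:x, slope e x:]"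
      by (simp add: fps_of_poly_pCons)
    from fps_cutoff_power_cong[OF x[unfolded this], of i]
    have "fps_cutoff q (series_of \<delta> (x ^ i)) = fps_cutoff q (fps_of_poly ([:x, slope e x:] ^ i))"
      by (simp only: series_power fps_of_poly_power)
    then show "\<delta> n (x ^ i) = coeff ([:x, slope e x:] ^ i) n"
      using assms(2) by (simp add: fps_cutoff_eq_fps_cutoff_iff)
  qed
  also have "\<dots> = coeff (pcompose h [:x, slope e x:]) n"
    by (simp add: pcompose_altdef poly_altdef degree_map_poly coeff_map_poly coeff_sum)
  finally show ?thesis .
qed

lemma extension_exists:
  assumes surj: "surj (\<lambda>a::'k. a ^ p)"
  shows "\<exists>D. (\<forall>N. iterative_upto (p ^ N) \<phi> (model_fgl e) D) \<and> (\<forall>n<q. D n = \<delta> n)"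
proof -
  have range: "range \<phi> \<subseteq> constants_upto q \<delta>" using base_constant by blast
  have range_p: "range \<phi> \<subseteq> (\<lambda>a. a ^ p) ` range \<phi>"
  proof
    fix b assume "b \<in> range \<phi>"
    then obtain c where "b = \<phi> (c ^ p)" using surj by (metis imageE surjD)
    then show "b \<in> (\<lambda>a. a ^ p) ` range \<phi>" by (simp add: algebra_map_power[OF \<phi>])
  qed
  have power_q: "u ^ (p ^ Suc m) \<in> constants_upto q \<delta>" for u
    using power_q_constant[of u] unfolding q .
  obtain M where M: "M 0 = constants_upto q \<delta>" "\<And>n. is_subring (M n)"
    "\<And>n u. u ^ (p ^ Suc (m + n)) \<in> M n" "\<And>n. x ^ (p ^ (m + n)) \<notin> M n" "\<And>n. adjoin (M n) x = UNIV"
    "\<And>n. range \<phi> \<subseteq> M n" "\<And>n. M (Suc n) \<subseteq> M n"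
    by (rule descending_subring_chain[OF p(1) char_r[symmetric] is_subring_constants
          power_q power_not_constant adjoin_constants range range_p], rule that)
  have mono: "M n \<subseteq> M l" if "l \<le> n" for l n
    using lift_Suc_antimono_le[of M, OF M(7) that] .
  let ?r = "[:x, slope e x:]"
  \<comment> \<open>The n-th component uses the n-th field: n < p^n, so n is below the bound up to
    which substitution over \<open>M n\<close> is well defined.\<close>
  define D where "D = (\<lambda>n y. coeff (pcompose (SOME h. h \<in> polys_over (M n) \<and> poly h x = y) ?r) n)"
  have lt: "n < p ^ Suc (m + l)" if "n \<le> l" for n l
  proof -
    have "n < p ^ n" using power_gt_expt[of p n] prime_gt_1_nat[OF p(1)] by simp
    also have "\<dots> \<le> p ^ Suc (m + l)"
      using that prime_gt_0_nat[OF p(1)] by (intro power_increasing) auto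
    finally show ?thesis .
  qed
  have unique: "coeff (pcompose h ?r) n = coeff (pcompose h' ?r) n"
    if "h \<in> polys_over (M l)" "h' \<in> polys_over (M l)" "poly h x = poly h' x" "n < p ^ Suc (m + l)"
    for h h' n l
    by (rule coeff_pcompose_eq_if_poly_eq[OF p(1) char_r[symmetric] M(2) M(3) M(3) M(4) that])
  have repr: "\<exists>h. h \<in> polys_over (M l) \<and> poly h x = y" for y l
  proof -
    have "y \<in> adjoin (M l) x" by (simp add: M(5))
    then show ?thesis by (auto simp: adjoin_def)
  qed
  have D: "D n (poly h x) = coeff (pcompose h ?r) n" if h: "h \<in> polys_over (M l)" "n < p ^ Suc (m + l)" for n h l
  proof -
    define h' where "h' = (SOME h'. h' \<in> polys_over (M n) \<and> poly h' x = poly h x)"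
    have h': "h' \<in> polys_over (M n)" "poly h' x = poly h x"
      using someI_ex[OF repr[of n "poly h x"]] by (simp_all add: h'_def)
    \<comment> \<open>The two representations are compared over the larger of the two fields, where
      n is still within the admissible bound.\<close>
    have "coeff (pcompose h' ?r) n = coeff (pcompose h ?r) n"
    proof (cases "n \<le> l")
      case True
      then show ?thesis
        using h h' polys_over_mono[OF mono[OF True]] by (intro unique[of _ n]) (auto intro: lt simp del: power_Suc)
    next
      case False
      then have "l \<le> n" by simp
      then show ?thesis
        using h h' polys_over_mono[OF mono[OF \<open>l \<le> n\<close>]] by (intro unique[of _ l]) auto
    qed
    then show ?thesis by (simp add: D_def h'_def)
  qed
  have DD: "D n (poly h x) = coeff (pcompose h ?r) n" if h: "h \<in> polys_over (M N)" "n < p ^ N" for n h N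
  proof (rule D[OF h(1)])
    have "p ^ N \<le> p ^ Suc (m + N)" using prime_gt_0_nat[OF p(1)] by (intro power_increasing) auto
    then show "n < p ^ Suc (m + N)" using h(2) by linarith
  qed
  have "iterative_upto (p ^ N) \<phi> (model_fgl e) D" for N
  proof -
    note P = is_subring_polys_over[OF M(2)[of N]]
    have DHS: "truncated_HS_derivation (p ^ N) \<phi> D"
      unfolding truncated_HS_derivation_def
    proof (intro conjI allI impI)
      show "D 0 = id"
      proof
        fix y
        obtain h where "h \<in> polys_over (M 0)" "poly h x = y" using repr by blast
        then show "D 0 y = id y" using DD[of h 0 0] by (auto simp: coeff_pcompose_0)
      qed
      fix n y z assume n: "n < p ^ N"
      obtain h h' where h: "h \<in> polys_over (M N)" "poly h x = y" "h' \<in> polys_over (M N)" "poly h' x = z"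
        using repr by blast
      have "h + h' \<in> polys_over (M N)" "h * h' \<in> polys_over (M N)"
        using P h by (auto simp: is_subring_def)
      then have "D n (y + z) = coeff (pcompose (h + h') ?r) n" "D n (y * z) = coeff (pcompose (h * h') ?r) n"
        using DD[OF _ n, of "h + h'"] DD[OF _ n, of "h * h'"] h by simp_all
      moreover have "D i y = coeff (pcompose h ?r) i" "D i z = coeff (pcompose h' ?r) i" if "i \<le> n" for i
        using DD[OF h(1), of i] DD[OF h(3), of i] that n h by simp_all
      ultimately show "D n (y + z) = D n y + D n z" "D n (y * z) = (\<Sum>i\<le>n. D i y * D (n - i) z)"
        by (simp_all add: pcompose_add pcompose_mult coeff_mult)
    next
      fix n c assume n: "0 < n \<and> n < p ^ N"
      have "[:\<phi> c:] \<in> polys_over (M N)" using M(6) by (intro polys_over_const M(2)) blast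
      then show "D n (\<phi> c) = 0" using DD[of "[:\<phi> c:]" N n] n by (simp add: coeff_pCons split: nat.split)
    qed
    have Dscale: "D n (c * y) = c * D n y" if "c \<in> M N" "n < p ^ N" for n c y
    proof (rule truncated_HS_derivation_scale[OF DHS _ that(2)])
      show "D k c = 0" if "0 < k" "k < p ^ N" for k
        using DD[OF polys_over_const[OF M(2) \<open>c \<in> M N\<close>] that(2)] that(1)
        by (simp add: coeff_pCons split: nat.split)
    qed
    have Dx: "D n (x ^ a) = of_nat (a choose n) * slope e x ^ n * x ^ (a - n)" if n: "n < p ^ N" for n a
    proof -
      have "monom 1 a \<in> polys_over (M N)" using M(2)[of N] by (intro polys_over_monom) (auto simp: is_subring_def)
      then have "D n (x ^ a) = coeff (?r ^ a) n"
        using DD[of "monom 1 a" N n] n by (simp add: poly_monom pcompose_monom_1)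
      also have "\<dots> = of_nat (a choose n) * slope e x ^ n * x ^ (a - n)"
      proof (cases "n \<le> a")
        case False
        have "degree (?r ^ a) \<le> a" using degree_power_le[of ?r a] by (simp split: if_splits)
        then show ?thesis using False by (simp add: coeff_eq_0 binomial_eq_0)
      qed (rule coeff_linear_poly_power)
      finally show ?thesis .
    qed
    \<comment> \<open>D is linear over \<open>M N\<close> below p^N and the powers of x span K over
      it, so iterativity is checked on x^a.\<close>
    have mon: "D i (D j (x ^ a)) = (\<Sum>n<p ^ N. \<phi> ((model_fgl e ^ n) $ j $ i) * D n (x ^ a))"
      if ij: "i < p ^ N" "j < p ^ N" for i j a
    proof -
      let ?c = "\<lambda>n. \<phi> ((model_fgl e ^ n) $ j $ i)"
      let ?d = "\<lambda>n. of_nat (a choose n) * slope e x ^ n * x ^ (a - n)"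
      have c0: "?c n = 0" if "p ^ N \<le> n" for n
      proof -
        have "(model_fgl e ^ n) $ j $ i = 0"
          by (rule fps2_power_nth_eq_0_prime_char[where N = N, OF model_fgl_0_0 _ _ ij that])
             (use p in auto)
        then show ?thesis using \<phi> by (simp add: algebra_map_0)
      qed
      have "(\<Sum>n<p ^ N. ?c n * D n (x ^ a)) = (\<Sum>n<p ^ N. ?c n * ?d n)"
        by (intro sum.cong refl) (simp add: Dx)
      \<comment> \<open>A range long enough to contain both the single index i + j of the additive
        case and all n <= a of the multiplicative one.\<close>
      also have "\<dots> = (\<Sum>n\<le>p ^ N + (i + j + a). ?c n * ?d n)"
        using c0 by (intro sum.mono_neutral_left) auto
      also have "\<dots> = D i (D j (x ^ a))"
      proof (cases "e = 0")
        case True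
        have "D i (D j (x ^ a)) = of_nat (a choose j) * D i (x ^ (a - j))"
          using True ij subring_of_nat[OF M(2)[of N]] by (simp add: Dx[OF ij(2)] slope_def Dscale)
        also have "\<dots> = of_nat ((a choose j) * ((a - j) choose i)) * x ^ (a - (i + j))"
          using True by (simp add: Dx[OF ij(1)] slope_def add.commute)
        also have "\<dots> = \<phi> ((model_fgl e ^ (i + j)) $ j $ i) * ?d (i + j)"
          using True \<phi> by (simp add: choose_iterated additive_model_power_nth slope_def algebra_map_simps)
        also have "\<dots> = (\<Sum>n\<in>{i + j}. ?c n * ?d n)" by simp
        also have "\<dots> = (\<Sum>n\<le>p ^ N + (i + j + a). ?c n * ?d n)"
          using True \<phi> by (intro sum.mono_neutral_left) (auto simp: additive_model_power_nth algebra_map_0)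
        finally show ?thesis by simp
      next
        case False
        then have e1: "e = 1" using e by simp
        \<comment> \<open>Here x^a is an eigenvector: g^n x^(a-n) = x^a because g = x.\<close>
        have xa: "?d n = of_nat (a choose n) * x ^ a" for n
          using e1 by (cases "n \<le> a") (simp_all add: slope_def binomial_eq_0 mult.assoc flip: power_add)
        have Dx': "D n (x ^ a) = of_nat (a choose n) * x ^ a" if "n < p ^ N" for n
          using that by (simp only: Dx xa)
        have "D i (D j (x ^ a)) = of_nat (a choose j) * of_nat (a choose i) * x ^ a"
          using ij subring_of_nat[OF M(2)[of N]] by (simp only: Dx' Dscale mult.assoc)
        also have "\<dots> = \<phi> (\<Sum>n\<le>a. of_nat (a choose n) * (model_fgl e ^ n) $ j $ i) * x ^ a"
          using \<phi> by (simp only: e1 multiplicative_model_binomial) (simp add: algebra_map_simps)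
        also have "\<dots> = (\<Sum>n\<le>a. ?c n * ?d n)"
          unfolding xa by (simp add: algebra_map_simps[OF \<phi>] sum_distrib_left sum_distrib_right mult_ac)
        also have "\<dots> = (\<Sum>n\<le>p ^ N + (i + j + a). ?c n * ?d n)"
          by (intro sum.mono_neutral_left) (auto simp: binomial_eq_0)
        finally show ?thesis by simp
      qed
      finally show ?thesis by simp
    qed
    show ?thesis
      unfolding iterative_upto_def
    proof (intro conjI allI impI DHS)
      fix i j y assume ij: "i < p ^ N" "j < p ^ N"
      obtain h where h: "h \<in> polys_over (M N)" "poly h x = y" using repr by blast
      have y: "y = (\<Sum>a\<le>degree h. coeff h a * x ^ a)" using h(2) by (simp add: poly_altdef)
      have hM: "coeff h a \<in> M N" for a using h(1) by (simp add: polys_over_def)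
      have Dy: "D n y = (\<Sum>a\<le>degree h. coeff h a * D n (x ^ a))" if "n < p ^ N" for n
        unfolding y truncated_HS_derivation_sum[OF DHS that] using that by (simp add: Dscale hM)
      have "D i (D j y) = (\<Sum>a\<le>degree h. coeff h a * D i (D j (x ^ a)))"
        unfolding Dy[OF ij(2)] truncated_HS_derivation_sum[OF DHS ij(1)] using ij by (simp add: Dscale hM)
      also have "\<dots> = (\<Sum>a\<le>degree h. \<Sum>n<p ^ N. coeff h a * (\<phi> ((model_fgl e ^ n) $ j $ i) * D n (x ^ a)))"
        by (simp only: mon[OF ij] sum_distrib_left)
      also have "\<dots> = (\<Sum>n<p ^ N. \<Sum>a\<le>degree h. coeff h a * (\<phi> ((model_fgl e ^ n) $ j $ i) * D n (x ^ a)))"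
        by (rule sum.swap)
      also have "\<dots> = (\<Sum>n<p ^ N. \<phi> ((model_fgl e ^ n) $ j $ i) * D n y)"
        by (intro sum.cong refl) (simp add: Dy sum_distrib_left mult_ac)
      finally show "D i (D j y) = (\<Sum>n<p ^ N. \<phi> ((model_fgl e ^ n) $ j $ i) * D n y)" .
    qed
  qed
  moreover have "D n = \<delta> n" if "n < q" for n
  proof
    fix y
    obtain h where h: "h \<in> polys_over (M 0)" "poly h x = y" using repr by blast
    \<comment> \<open>At level 0 the admissible bound is exactly q.\<close>
    have "D n (poly h x) = coeff (pcompose h ?r) n" using D[OF h(1), of n] that by (simp add: q)
    also have "\<dots> = \<delta> n (poly h x)" using \<delta>_poly[of h n] h(1) M(1) that by simp
    finally show "D n y = \<delta> n y" using h(2) by simp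
  qed
  ultimately show ?thesis by blast
qed

end

end

section \<open>Integration\<close>

text \<open>Serves the base case of the induction, where p^0 = 1 and only
  \<open>\<delta> 0 = id\<close> is prescribed.\<close>

lemma iterative_upto_trivial:
  fixes \<phi> :: "'k::field \<Rightarrow> 'r::field"
  assumes \<phi>: "algebra_map \<phi>" and "q > 0"
  shows "iterative_upto q \<phi> F (\<lambda>n. if n = 0 then id else (\<lambda>_. 0))"
    (is "iterative_upto q \<phi> F ?D")
  unfolding iterative_upto_def truncated_HS_derivation_def
proof (intro conjI allI impI)
  fix n x y
  have "(\<Sum>i\<le>n. ?D i x * ?D (n - i) y) = (\<Sum>i\<in>{0}. ?D i x * ?D (n - i) y)"
    by (intro sum.mono_neutral_right) auto
  then show "?D n (x * y) = (\<Sum>i\<le>n. ?D i x * ?D (n - i) y)" by simp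
next
  fix i j r
  have "(\<Sum>n<q. \<phi> ((F ^ n) $ j $ i) * ?D n r) = (\<Sum>n\<in>{0}. \<phi> ((F ^ n) $ j $ i) * ?D n r)"
    using assms(2) by (intro sum.mono_neutral_right) auto
  then show "?D i (?D j r) = (\<Sum>n<q. \<phi> ((F ^ n) $ j $ i) * ?D n r)"
    using \<phi> by (simp add: algebra_map_simps)
qed auto

lemma model_integrable:
  fixes \<phi> :: "'k::field \<Rightarrow> 'r::field"
  assumes \<phi>: "algebra_map \<phi>" and p: "prime p" "p = CHAR('k)" and e: "e = 0 \<or> e = 1"
    and surj: "surj (\<lambda>a::'k. a ^ p)"
    and \<delta>: "iterative_upto (p ^ m) \<phi> (model_fgl e) \<delta>"
  shows "\<exists>D. (\<forall>N. iterative_upto (p ^ N) \<phi> (model_fgl e) D) \<and> (\<forall>n<p ^ m. D n = \<delta> n)"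
  using \<delta>
proof (induction m arbitrary: \<delta>)
  case 0
  then have "\<delta> 0 = id" by (simp add: iterative_upto_def truncated_HS_derivation_def)
  then show ?case
    using iterative_upto_trivial[OF \<phi>] prime_gt_0_nat[OF p(1)]
    by (intro exI[of _ "\<lambda>n. if n = 0 then id else (\<lambda>_. 0)"]) auto
next
  case (Suc m)
  have p0: "p > 0" using prime_gt_0_nat[OF p(1)] .
  have ep: "e ^ p = e" using e p0 by auto
  show ?case
  proof (cases "\<delta> 1 = (\<lambda>_. 0)")
    case False
    obtain x where "x \<noteq> 0" "fps_cutoff (p ^ Suc m) (series_of \<delta> x) =
        fps_cutoff (p ^ Suc m) (fps_const x + fps_const (slope e x) * fps_X)"
      using coordinate[OF \<phi> p refl e Suc.prems False] .
    then show ?thesis by (rule extension_exists[OF \<phi> p refl e Suc.prems _ _ surj])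
  next
    case True
    have 0: "\<delta> n r = 0" if "n < p ^ Suc m" "\<not> p dvd n" for n r
      using iterative_upto_eq_0_if_not_dvd[OF \<phi> p Suc.prems True that] .
    have "iterative_upto (p ^ m) \<phi> (model_fgl e) (\<lambda>n. \<delta> (p * n))"
      using Suc.prems 0 by (intro iterative_upto_contract[OF \<phi> p ep]) auto
    then obtain D where D: "\<And>N. iterative_upto (p ^ N) \<phi> (model_fgl e) D" "\<And>n. n < p ^ m \<Longrightarrow> D n = \<delta> (p * n)"
      using Suc.IH by blast
    let ?E = "\<lambda>n. if p dvd n then D (n div p) else (\<lambda>_. 0)"
    have "iterative_upto (p ^ N) \<phi> (model_fgl e) ?E" for N
      by (rule iterative_upto_expand[OF \<phi> p ep refl D(1)])
    moreover have "?E n = \<delta> n" if "n < p ^ Suc m" for n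
      using 0[OF that] that p0 D(2) by (auto elim!: dvdE)
    ultimately show ?thesis by blast
  qed
qed

lemma formal_group_law_0_0:
  assumes "formal_group_law F"
  shows "F $ 0 $ 0 = 0"
proof -
  have "subst22 F X2 0 $ 0 $ 0 = X2 $ 0 $ 0" using assms by (simp add: formal_group_law_def)
  then show ?thesis by (simp add: subst22_def)
qed

theorem theorem1p1:
  fixes \<phi> :: "'k::field \<Rightarrow> 'K::field"
    and F :: "'k fps fps"
    and p m :: nat
    and \<delta> :: "nat \<Rightarrow> 'K \<Rightarrow> 'K"
  assumes "CHAR('k) = p" and "p > 0"
    and "perfect_field TYPE('k)"
    and "algebra_map \<phi>"
    and "m > 0"
    and "formal_group_law F"
    and "fgl_isomorphic F additive_fgl \<or> fgl_isomorphic F multiplicative_fgl"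
    and "truncated_F_derivation (p ^ m) \<phi> F \<delta>"
  shows "\<exists>D. F_derivation \<phi> F D \<and> (\<forall>n<p ^ m. D n = \<delta> n)"
proof -
  note \<phi> = \<open>algebra_map \<phi>\<close>
  have p: "prime p" "p = CHAR('k)"
    using assms(1,2) prime_CHAR_semidom[where 'a = 'k] by auto
  have surj: "surj (\<lambda>a::'k. a ^ p)" using assms(1-3) by (auto simp: perfect_field_def)
  have "\<exists>e::'k. (e = 0 \<or> e = 1) \<and> fgl_isomorphic F (model_fgl e)"
    using assms(7) by (auto simp: model_fgl_def additive_fgl_def multiplicative_fgl_def)
  then obtain e :: 'k where e: "e = 0 \<or> e = 1" and "fgl_isomorphic F (model_fgl e)" by blast
  then obtain a b where a: "fgl_hom F (model_fgl e) a" and b: "fgl_hom (model_fgl e) F b" and ba: "b oo a = fps_X"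
    unfolding fgl_isomorphic_def by blast
  have ab0: "a $ 0 = 0" "b $ 0 = 0" using a b by (simp_all add: fgl_hom_def)
  have F0: "F $ 0 $ 0 = 0" using assms(6) by (rule formal_group_law_0_0)
  have pk: "prime CHAR('k)" using p by simp
  have "iterative_upto (p ^ m) \<phi> F \<delta>"
    using \<phi> assms(8) by (rule truncated_F_derivation_imp_iterative_upto)
  \<comment> \<open>By contravariance \<open>b\<close>, which goes from the model to F, carries the
    given derivation to the model; \<open>a\<close> brings the integrated one back.\<close>
  then have "iterative_upto (p ^ m) \<phi> (model_fgl e) (transport \<phi> b \<delta>)"
    using p(2) by (intro iterative_upto_transport[OF \<phi> pk _ b model_fgl_0_0]) auto
  then obtain D where D: "\<And>N. iterative_upto (p ^ N) \<phi> (model_fgl e) D"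
    "\<And>n. n < p ^ m \<Longrightarrow> D n = transport \<phi> b \<delta> n"
    using model_integrable[OF \<phi> p e surj] by blast
  have "iterative_upto (p ^ N) \<phi> F (transport \<phi> a D)" for N
    using D(1)[of N] p(2) by (intro iterative_upto_transport[OF \<phi> pk _ a F0]) auto
  then have "F_derivation \<phi> F (transport \<phi> a D)"
    by (rule F_derivationI[OF \<phi> p(1) F0])
  moreover have "transport \<phi> a D n = \<delta> n" if "n < p ^ m" for n
    using D(2) that by (intro transport_transport[OF \<phi> ab0 ba]) auto
  ultimately show ?thesis by blast
qed

end
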